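(* Fix $K \ge 1$ and $c>0$. For each $n\ge 2$ let $P=P_n\in[0,1]^{n\times n}$ be symmetric with $P_{ii}=0$ for all $i$, let $\rho=\frac{1}{n(n-1)}\sum_{i,j}P_{ij}$, and let $A\in\{0,1\}^{n\times n}$ be a random symmetric matrix with zero diagonal whose entries $A_{ij}$, $i<j$, are independent with $A_{ij}\sim\mathrm{Bernoulli}(P_{ij})$. Let $\hat\theta=\hat\theta_n\in[0,1]^{K\times K}$ be symmetric (possibly depending on $n$). Assume that for all $n$: (1) $\rho\ge 1/n$; (2) $\frac{\rho}{c}\le \frac{\hat\theta_{ab}}{1-\hat\theta_{ab}}\le c\rho$ for all $a,b\in[K]$. Let $\hat X$ be any solution of the semidefinite program defined in the context (with data $A$ and parameter $\hat\theta$), and let $\tilde P$ be the randomized estimate of $P$ built from $\hat X$ as in the context. Then $$\frac{1}{n^2\rho}\sum_{i=1}^n\sum_{j=1}^n \mathrm{KL}(P_{ij},\tilde P_{ij})\ \le\ \frac{1}{n^2\rho}\min_{z\in[K]^n}\sum_{i=1}^n\sum_{j=1}^n \mathrm{KL}(P_{ij},\hat\theta_{z_i,z_j})+O_P\left(\frac{1}{\sqrt{n\rho}}\right),$$ where the constants in the $O_P(\cdot)$ term depend only on $K$ and $c$.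
   Context: Notation. $[m]=\{1,\dots,m\}$. For $M\in\mathbb R^{nK\times nK}$ and $i,j\in[n]$, $M^{(ij)}\in\mathbb R^{K\times K}$ is the $(i,j)$ block, $M^{(ij)}_{ab}=M_{a+(i-1)K,\,b+(j-1)K}$. $\langle M,N\rangle=\sum_{k,l}M_{kl}N_{kl}$. $X\succeq 0$ means symmetric positive semidefinite; $X\ge 0$ means entrywise nonnegative. For $p\in[0,1]$, $q\in(0,1)$, $\mathrm{KL}(p,q)=p\log\frac pq+(1-p)\log\frac{1-p}{1-q}$ with $0\log 0=0$. Semidefinite program. Given $A$ and $\hat\theta$, let $F\in\mathbb R^{nK\times nK}$ have blocks $F^{(ij)}_{ab}=A_{ij}\log\hat\theta_{ab}+(1-A_{ij})\log(1-\hat\theta_{ab})$ for $i,j\in[n]$, $a,b\in[K]$. The program is: maximize $\langle F,X\rangle$ over $$\mathcal X=\Big\{X\in\mathbb R^{nK\times nK}: X\succeq 0,\ X\ge 0,\ \sum_{a=1}^K\sum_{b=1}^K X^{(ij)}_{ab}=1\ \text{ for all } i,j\in[n]\Big\}.$$ $\hat X$ denotes a maximizer (a function of $A$). Randomized estimate. Conditionally on $A$ (hence on $\hat X$), the entries $\tilde P_{ij}$, $i\le j$, are independent, with $\tilde P_{ij}=\hat\theta_{ab}$ with probability $\hat X^{(ij)}_{ab}$ (i.e. draw $(a,b)\in[K]^2$ with probability $\hat X^{(ij)}_{ab}$ and set $\tilde P_{ij}=\hat\theta_{ab}$), and $\tilde P_{ji}=\tilde P_{ij}$. Meaning of the bound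 "$U_n\le W_n+O_P(r_n)$ with constants depending only on $K,c$": for every $\epsilon>0$ there is $M$ depending only on $\epsilon,K,c$ such that $\mathbb P(U_n>W_n+M r_n)\le\epsilon$ for all $n$. Probability is over both $A$ and the randomization in $\tilde P$. *)

theory Defs
  imports "HOL-Probability.Probability" "Jordan_Normal_Form.Matrix"
begin

(* Matrices whose size depends on n are elements of carrier_mat. All indices start at 0: nodes are
   i < n, classes are a < K, and entry (i * K + a, j * K + b) of a matrix of size n * K is
   entry (a, b) of its (i, j) block. *)

definition block :: "nat \<Rightarrow> real mat \<Rightarrow> nat \<Rightarrow> nat \<Rightarrow> real mat" where
  "block K M i j = Matrix.mat K K (\<lambda>(a, b). M $$ (i * K + a, j * K + b))"

definition mat_inner :: "real mat \<Rightarrow> real mat \<Rightarrow> real" where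
  "mat_inner M N = (\<Sum>k<dim_row M. \<Sum>l<dim_col M. M $$ (k, l) * N $$ (k, l))"

definition symmetric_mat :: "real mat \<Rightarrow> bool" where
  "symmetric_mat M \<longleftrightarrow> transpose_mat M = M"

definition psd_mat :: "real mat \<Rightarrow> bool" where
  "psd_mat M \<longleftrightarrow> symmetric_mat M \<and>
     (\<forall>v \<in> carrier_vec (dim_row M). 0 \<le> scalar_prod v (mult_mat_vec M v))"

(* As ln 0 = 0 in HOL, the convention 0 log 0 = 0 holds here. *)
definition KL :: "real \<Rightarrow> real \<Rightarrow> real" where
  "KL p q = p * ln (p / q) + (1 - p) * ln ((1 - p) / (1 - q))"

definition sdp_objective :: "nat \<Rightarrow> nat \<Rightarrow> real mat \<Rightarrow> real mat \<Rightarrow> real mat" where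
  "sdp_objective n K A \<theta> = Matrix.mat (n * K) (n * K) (\<lambda>(k, l).
     A $$ (k div K, l div K) * ln (\<theta> $$ (k mod K, l mod K))
     + (1 - A $$ (k div K, l div K)) * ln (1 - \<theta> $$ (k mod K, l mod K)))"

lemma block_sdp_objective:
  assumes "i < n" "j < n" "a < K" "b < K"
  shows "block K (sdp_objective n K A \<theta>) i j $$ (a, b)
    = A $$ (i, j) * ln (\<theta> $$ (a, b)) + (1 - A $$ (i, j)) * ln (1 - \<theta> $$ (a, b))"
proof -
  have *: "i * K + a < n * K" if "i < n" "a < K" for i a :: nat
  proof -
    have "i * K + a < Suc i * K" using that by simp
    also have "\<dots> \<le> n * K" using that by (intro mult_le_mono1) simp
    finally show ?thesis .
  qed
  show ?thesis
    using assms *[of i a] *[of j b] by (simp add: block_def sdp_objective_def)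
qed

definition sdp_feasible :: "nat \<Rightarrow> nat \<Rightarrow> real mat set" where
  "sdp_feasible n K = {X \<in> carrier_mat (n * K) (n * K).
     psd_mat X \<and>
     (\<forall>k < n * K. \<forall>l < n * K. 0 \<le> X $$ (k, l)) \<and>
     (\<forall>i < n. \<forall>j < n. (\<Sum>a<K. \<Sum>b<K. block K X i j $$ (a, b)) = 1)}"

definition sdp_solution :: "nat \<Rightarrow> nat \<Rightarrow> real mat \<Rightarrow> real mat \<Rightarrow> real mat \<Rightarrow> bool" where
  "sdp_solution n K A \<theta> X \<longleftrightarrow>
     is_arg_max (mat_inner (sdp_objective n K A \<theta>)) (\<lambda>Y. Y \<in> sdp_feasible n K) X"

definition mean_density :: "nat \<Rightarrow> real mat \<Rightarrow> real" where
  "mean_density n P = (\<Sum>i<n. \<Sum>j<n. P $$ (i, j)) / (real n * (real n - 1))"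

(* Law of the adjacency matrix: independent Bernoulli edges, the graph being determined by the
   set of pairs i < j. *)
definition graph_pmf :: "nat \<Rightarrow> real mat \<Rightarrow> real mat pmf" where
  "graph_pmf n P =
     map_pmf (\<lambda>e. Matrix.mat n n (\<lambda>(i, j).
         if i = j then 0 else of_bool (e (min i j, max i j))))
       (Pi_pmf {(i, j). i < j \<and> j < n} False (\<lambda>(i, j). bernoulli_pmf (P $$ (i, j))))"

definition block_pmf :: "nat \<Rightarrow> real mat \<Rightarrow> nat \<Rightarrow> nat \<Rightarrow> (nat \<times> nat) pmf" where
  "block_pmf K X i j =
     embed_pmf (\<lambda>(a, b). if a < K \<and> b < K then block K X i j $$ (a, b) else 0)"

(* For feasible X the weights really are a probability distribution, as embed_pmf requires. *)
lemma pmf_block_pmf: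
  assumes X: "X \<in> sdp_feasible n K" and ij: "i < n" "j < n"
  shows "pmf (block_pmf K X i j) (a, b) =
    (if a < K \<and> b < K then block K X i j $$ (a, b) else 0)"
proof -
  define f where "f = (\<lambda>(a, b). if a < K \<and> b < K then block K X i j $$ (a, b) else 0)"
  have *: "i * K + a < n * K" if "i < n" "a < K" for i a :: nat
  proof -
    have "i * K + a < Suc i * K" using that by simp
    also have "\<dots> \<le> n * K" using that by (intro mult_le_mono1) simp
    finally show ?thesis .
  qed
  have nn: "0 \<le> f x" for x
    using X ij * by (auto simp: f_def block_def sdp_feasible_def split: prod.split)
  have "(\<integral>\<^sup>+ x. ennreal (f x) \<partial>count_space UNIV)
      = (\<Sum>x \<in> {..<K} \<times> {..<K}. ennreal (f x))"
    by (rule nn_integral_count_space'[where A = "{..<K} \<times> {..<K}"])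
       (auto simp: f_def split: prod.splits if_splits)
  also have "\<dots> = ennreal (\<Sum>x \<in> {..<K} \<times> {..<K}. f x)"
    using nn by (intro sum_ennreal) auto
  also have "(\<Sum>x \<in> {..<K} \<times> {..<K}. f x) = (\<Sum>a<K. \<Sum>b<K. block K X i j $$ (a, b))"
    unfolding sum.cartesian_product by (intro sum.cong) (auto simp: f_def)
  also have "\<dots> = 1"
    using X ij by (simp add: sdp_feasible_def)
  finally have "pmf (embed_pmf f) (a, b) = f (a, b)"
    using nn by (intro pmf_embed_pmf) auto
  thus ?thesis by (simp add: block_pmf_def f_def)
qed

(* Conditional law of the randomized estimate when the solution of the program is X: for every
   pair i \<le> j a pair of classes (a, b) is drawn from block (i, j) of X, independently. *)
definition estimate_pmf :: "nat \<Rightarrow> nat \<Rightarrow> real mat \<Rightarrow> real mat \<Rightarrow> real mat pmf" where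
  "estimate_pmf n K \<theta> X =
     map_pmf (\<lambda>s. Matrix.mat n n (\<lambda>(i, j). \<theta> $$ s (min i j, max i j)))
       (Pi_pmf {(i, j). i \<le> j \<and> j < n} (0, 0) (\<lambda>(i, j). block_pmf K X i j))"

(* Law of the randomized estimate over both the graph and the drawing of classes. *)
definition randomized_estimate_pmf ::
  "nat \<Rightarrow> nat \<Rightarrow> real mat \<Rightarrow> real mat \<Rightarrow> (real mat \<Rightarrow> real mat) \<Rightarrow> real mat pmf" where
  "randomized_estimate_pmf n K P \<theta> Xhat =
     bind_pmf (graph_pmf n P) (\<lambda>A. estimate_pmf n K \<theta> (Xhat A))"

(* A parameter equal to 1 is excluded, although x / 0 = 0 in HOL: the lower bound on the odds is
   positive when c > 0. *)
definition admissible_model :: "nat \<Rightarrow> nat \<Rightarrow> real \<Rightarrow> real mat \<Rightarrow> real mat \<Rightarrow> bool" where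
  "admissible_model n K c P \<theta> \<longleftrightarrow>
     P \<in> carrier_mat n n \<and> symmetric_mat P \<and>
     (\<forall>i<n. \<forall>j<n. 0 \<le> P $$ (i, j) \<and> P $$ (i, j) \<le> 1) \<and>
     (\<forall>i<n. P $$ (i, i) = 0) \<and>
     \<theta> \<in> carrier_mat K K \<and> symmetric_mat \<theta> \<and>
     (\<forall>a<K. \<forall>b<K. 0 \<le> \<theta> $$ (a, b) \<and> \<theta> $$ (a, b) \<le> 1) \<and>
     mean_density n P \<ge> 1 / real n \<and>
     (\<forall>a<K. \<forall>b<K. mean_density n P / c \<le> \<theta> $$ (a, b) / (1 - \<theta> $$ (a, b)) \<and>
        \<theta> $$ (a, b) / (1 - \<theta> $$ (a, b)) \<le> c * mean_density n P)"

end

theory Submission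
  imports Defs
begin

text \<open>
  Up to terms that do not depend on the classes, the divergence \<open>KL P\<^sub>i\<^sub>j \<theta>\<^sub>a\<^sub>b\<close> is minus a score that is affine in
  \<open>P\<^sub>i\<^sub>j\<close> with slope the log-odds of \<open>\<theta>\<^sub>a\<^sub>b\<close>, and the objective of the semidefinite program is the
  total score with \<open>A\<close> in place of \<open>P\<close>. The solution \<open>X\<close> beats the rank-one feasible point of every labelling \<open>z\<close>
  for the data \<open>A\<close>. Hence its loss of score against \<open>z\<close> for the true \<open>P\<close> is at most twice the largest deviation
  of \<open>\<langle>(P - A) \<otimes> \<Lambda>, X\<rangle>\<close> over feasible \<open>X\<close>, where \<open>\<Lambda>\<close> holds the log-odds. Blocks of feasible matrices have total
  mass 1, so \<open>ln \<rho>\<close> may be subtracted from the log-odds, after which they are bounded by \<open>ln c\<close>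
  (\<open>mat_inner_sdp_objective\<close>, \<open>sdp_solution_near_optimal\<close>).

  For fixed classes \<open>a\<close>, \<open>b\<close> the entries of \<open>X\<close> are inner products of vectors in the unit ball
  (\<open>gram_factorization\<close>), so Grothendieck's inequality reduces the deviation to the maximum of
  \<open>\<Sum> (P - A)\<^sub>i\<^sub>j s\<^sub>i t\<^sub>j\<close> over sign vectors (\<open>grothendieck_inequality\<close>). That maximum is at most of order
  \<open>n sqrt (n \<rho>)\<close> with high probability by a Bernstein-type bound and a union bound over \<open>4 ^ n\<close> pairs of sign vectors
  (\<open>cut_bound_random_graph\<close>). Divided by \<open>n\<^sup>2 \<rho>\<close> this is the rate \<open>1 / sqrt (n \<rho>)\<close>.

  Given the graph, the expected divergence of the randomised estimate corresponds exactly to the score of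
  \<open>X\<close> under \<open>P\<close>, and the same tail bound for independent sums controls the fluctuation
  (\<open>estimate_pmf_concentration\<close>).

  Grothendieck's inequality is proved with a crude constant and finite probability spaces only: random
  signs embed the vectors isometrically as random variables, truncation makes them bounded, and the
  truncation error is reabsorbed into the quantity being bounded.
\<close>

section \<open>Gram representation of positive semidefinite kernels\<close>

text \<open>
  Cholesky factorisation by induction: the last index serves as pivot and the Schur complement
  \<open>R\<close> of the pivot is positive semidefinite on the remaining indices. A zero pivot forces its row and
  column to vanish, and then, since \<open>x / 0 = 0\<close>, the same formulas for \<open>R\<close> and \<open>w'\<close> stay correct.
\<close>

lemma gram_factorization:
  fixes Q :: "nat \<Rightarrow> nat \<Rightarrow> real"
  assumes "\<And>k l. k < m \<Longrightarrow> l < m \<Longrightarrow> Q k l = Q l k"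
    and "\<And>f. 0 \<le> (\<Sum>k<m. \<Sum>l<m. f k * Q k l * f l)"
  shows "\<exists>w. \<forall>k<m. \<forall>l<m. Q k l = (\<Sum>r<m. w k r * w l r)"
  using assms
proof (induction m arbitrary: Q)
  case 0
  then show ?case by simp
next
  case (Suc m)
  define q where "q = Q m m"
  have expand: "(\<Sum>k<Suc m. \<Sum>l<Suc m. f k * Q k l * f l)
      = (\<Sum>k<m. \<Sum>l<m. f k * Q k l * f l) + 2 * f m * (\<Sum>k<m. f k * Q k m) + f m * q * f m" for f
  proof -
    have "(\<Sum>l<m. f m * Q m l * f l) = f m * (\<Sum>k<m. f k * Q k m)"
      using Suc.prems(1)[of m] by (auto simp: sum_distrib_left intro!: sum.cong)
    moreover have "(\<Sum>k<m. f k * Q k m * f m) = f m * (\<Sum>k<m. f k * Q k m)"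
      by (simp add: sum_distrib_left mult.commute mult.assoc)
    ultimately show ?thesis
      by (simp add: sum.distrib q_def)
  qed
  have q0: "q \<ge> 0"
    using Suc.prems(2)[of "\<lambda>k. if k = m then 1 else 0"] by (simp add: expand q_def)
  have vanish: "Q k m = 0" if "q = 0" "k < m" for k
  proof (rule ccontr)
    assume nz: "Q k m \<noteq> 0"
    \<comment> \<open>Chosen so that the form takes the value \<open>-1\<close> at \<open>e\<^sub>k + x e\<^sub>m\<close>.\<close>
    define x where "x = - (Q k k + 1) / (2 * Q k m)"
    have "(\<Sum>j<m. \<Sum>l<m. (if j = k then 1 else if j = m then x else 0) * Q j l * (if l = k then 1 else if l = m then x else 0))
       = (\<Sum>j<m. \<Sum>l<m. (if j = k then if l = k then Q k k else 0 else 0))"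
      using that by (intro sum.cong) auto
    also have "\<dots> = (\<Sum>j<m. if j = k then Q k k else 0)"
      using that by (intro sum.cong) auto
    also have "\<dots> = Q k k" using that by simp
    finally have 1: "(\<Sum>j<m. \<Sum>l<m. (if j = k then 1 else if j = m then x else 0) * Q j l * (if l = k then 1 else if l = m then x else 0)) = Q k k" .
    have "(\<Sum>j<m. (if j = k then 1 else if j = m then x else 0) * Q j m) = (\<Sum>j<m. if j = k then Q k m else 0)"
      by (intro sum.cong) auto
    also have "\<dots> = Q k m" using that by simp
    finally have "0 \<le> Q k k + 2 * x * Q k m"
      using Suc.prems(2)[of "\<lambda>j. if j = k then 1 else if j = m then x else 0"] that 1
      unfolding expand by simp
    also have "2 * x * Q k m = - (Q k k + 1)" using nz by (simp add: x_def field_simps)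
    finally show False by simp
  qed
  define R where "R k l = Q k l - Q k m * Q l m / q" for k l
  have "\<exists>w. \<forall>k<m. \<forall>l<m. R k l = (\<Sum>r<m. w k r * w l r)"
  proof (rule Suc.IH)
    show "R k l = R l k" if "k < m" "l < m" for k l
      using Suc.prems(1)[of k l] that by (simp add: R_def)
    show "0 \<le> (\<Sum>k<m. \<Sum>l<m. f k * R k l * f l)" for f
    proof -
      define S where "S = (\<Sum>k<m. f k * Q k m)"
      \<comment> \<open>The last coordinate minimises the quadratic form over all extensions of \<open>f\<close>.\<close>
      define g where "g k = (if k = m then - S / q else f k)" for k
      have "(\<Sum>k<m. \<Sum>l<m. f k * (Q k m * Q l m / q) * f l) = S * S / q"
        unfolding S_def sum_product sum_divide_distrib by (intro sum.cong) auto
      then have "(\<Sum>k<m. \<Sum>l<m. f k * R k l * f l) = (\<Sum>k<m. \<Sum>l<m. f k * Q k l * f l) - S * S / q"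
        by (simp add: R_def algebra_simps sum_subtractf)
      also have "\<dots> = (\<Sum>k<Suc m. \<Sum>l<Suc m. g k * Q k l * g l)"
      proof (cases "q = 0")
        case True
        then have "S = 0" using vanish by (simp add: S_def)
        then show ?thesis unfolding expand using True by (simp add: g_def)
      next
        case False
        then show ?thesis unfolding expand by (simp add: g_def S_def[symmetric])
      qed
      also have "\<dots> \<ge> 0" by (rule Suc.prems(2))
      finally show ?thesis .
    qed
  qed
  then obtain w where w: "\<And>k l. k < m \<Longrightarrow> l < m \<Longrightarrow> R k l = (\<Sum>r<m. w k r * w l r)" by blast
  define w' where "w' k r = (if k = m then (if r = m then sqrt q else 0)
     else if r = m then Q k m / sqrt q else w k r)" for k r
  have "Q k l = (\<Sum>r<Suc m. w' k r * w' l r)" if kl: "k < Suc m" "l < Suc m" for k l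
  proof -
    consider "k < m" "l < m" | "k < m" "l = m" | "k = m" "l < m" | "k = m" "l = m"
      using kl by (auto simp: less_Suc_eq)
    then show ?thesis
    proof cases
      case 1
      then have "(\<Sum>r<m. w' k r * w' l r) = R k l"
        by (simp add: w w'_def)
      moreover have "w' k m * w' l m = Q k m * Q l m / q"
        using 1 q0 by (simp add: w'_def)
      ultimately show ?thesis by (simp add: R_def)
    next
      case 2
      then show ?thesis using vanish[of k] q0 by (simp add: w'_def)
    next
      case 3
      then show ?thesis using vanish[of l] q0 Suc.prems(1)[of l m] by (simp add: w'_def)
    next
      case 4
      then show ?thesis using q0 by (simp add: w'_def q_def)
    qed
  qed
  then show ?case by blast
qed

section \<open>Grothendieck's inequality\<close>

text \<open>
  \<open>B\<close> bounds the norm of \<open>M\<close> as an operator from \<open>\<ell>\<^sub>\<infinity>\<close> to \<open>\<ell>\<^sub>1\<close>, which agrees with its cut norm up to a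
  constant. Sign vectors form an extensional, hence finite, set, so that a union bound can run over
  them.
\<close>

definition cut_bound :: "nat \<Rightarrow> (nat \<Rightarrow> nat \<Rightarrow> real) \<Rightarrow> real \<Rightarrow> bool" where
  "cut_bound n M B \<longleftrightarrow> (\<forall>s \<in> {..<n} \<rightarrow>\<^sub>E {-1, 1}. \<forall>t \<in> {..<n} \<rightarrow>\<^sub>E {-1, 1}.
      (\<Sum>i<n. \<Sum>j<n. M i j * (s i * t j)) \<le> B)"

lemma sum_le_signed_sum:
  fixes c x :: "nat \<Rightarrow> real"
  assumes "\<And>i. i < n \<Longrightarrow> \<bar>x i\<bar> \<le> 1"
  shows "\<exists>s \<in> {..<n} \<rightarrow>\<^sub>E {-1, 1}. (\<Sum>i<n. c i * x i) \<le> (\<Sum>i<n. c i * s i)"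
proof
  show "(\<lambda>i\<in>{..<n}. if c i \<ge> 0 then 1 else -1) \<in> {..<n} \<rightarrow>\<^sub>E {-1, 1::real}" by auto
  have "c i * x i \<le> \<bar>c i\<bar>" if "i < n" for i
  proof -
    have "c i * x i \<le> \<bar>c i\<bar> * \<bar>x i\<bar>" by (simp add: abs_mult[symmetric])
    also have "\<dots> \<le> \<bar>c i\<bar> * 1" using assms[OF that] by (intro mult_left_mono) auto
    finally show ?thesis by simp
  qed
  then show "(\<Sum>i<n. c i * x i) \<le> (\<Sum>i<n. c i * (\<lambda>i\<in>{..<n}. if c i \<ge> 0 then 1 else -1) i)"
    by (intro sum_mono) (force simp: abs_if)
qed

text \<open>
  A bilinear form on a box attains its maximum at a vertex, because it is linear in each of the two
  vectors separately.
\<close>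

lemma cut_bound_box:
  assumes B: "cut_bound n M B"
    and x: "\<And>i. i < n \<Longrightarrow> \<bar>x i\<bar> \<le> T" and y: "\<And>j. j < n \<Longrightarrow> \<bar>y j\<bar> \<le> T" and T: "T > 0"
  shows "(\<Sum>i<n. \<Sum>j<n. M i j * (x i * y j)) \<le> T^2 * B"
proof -
  obtain s where s: "s \<in> {..<n} \<rightarrow>\<^sub>E {-1, 1}"
    "(\<Sum>i<n. (\<Sum>j<n. M i j * (y j / T)) * (x i / T)) \<le> (\<Sum>i<n. (\<Sum>j<n. M i j * (y j / T)) * s i)"
    using sum_le_signed_sum[of n "\<lambda>i. x i / T" "\<lambda>i. \<Sum>j<n. M i j * (y j / T)"] x T
    by (auto simp del: times_divide_eq_right)
  obtain t where t: "t \<in> {..<n} \<rightarrow>\<^sub>E {-1, 1}"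
    "(\<Sum>j<n. (\<Sum>i<n. M i j * s i) * (y j / T)) \<le> (\<Sum>j<n. (\<Sum>i<n. M i j * s i) * t j)"
    using sum_le_signed_sum[of n "\<lambda>j. y j / T" "\<lambda>j. \<Sum>i<n. M i j * s i"] y T
    by (auto simp del: times_divide_eq_right)
  have "(\<Sum>i<n. \<Sum>j<n. M i j * (x i * y j))
      = T^2 * (\<Sum>i<n. (\<Sum>j<n. M i j * (y j / T)) * (x i / T))"
    using T by (simp add: sum_distrib_left sum_distrib_right power2_eq_square mult_ac)
  also have "\<dots> \<le> T^2 * (\<Sum>i<n. (\<Sum>j<n. M i j * (y j / T)) * s i)"
    by (intro mult_left_mono s) simp
  also have "(\<Sum>i<n. (\<Sum>j<n. M i j * (y j / T)) * s i) = (\<Sum>j<n. (\<Sum>i<n. M i j * s i) * (y j / T))"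
    unfolding sum_distrib_right by (subst sum.swap) (simp add: mult_ac)
  also have "T^2 * \<dots> \<le> T^2 * (\<Sum>j<n. (\<Sum>i<n. M i j * s i) * t j)"
    by (intro mult_left_mono t) simp
  also have "(\<Sum>j<n. (\<Sum>i<n. M i j * s i) * t j) = (\<Sum>i<n. \<Sum>j<n. M i j * (s i * t j))"
    unfolding sum_distrib_right by (subst sum.swap) (simp add: mult_ac)
  also have "T^2 * \<dots> \<le> T^2 * B"
    using B s t by (intro mult_left_mono) (auto simp: cut_bound_def)
  finally show ?thesis .
qed

text \<open>
  A vector of \<open>d\<close> independent uniform signs is encoded by the set of its positive coordinates, so that
  expectations are plain averages over a power set.
\<close>

definition rademacher_mean :: "nat \<Rightarrow> (nat set \<Rightarrow> real) \<Rightarrow> real" where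
  "rademacher_mean d f = (\<Sum>S \<in> Pow {..<d}. f S) / 2 ^ d"

definition rademacher_sum :: "nat \<Rightarrow> (nat \<Rightarrow> real) \<Rightarrow> nat set \<Rightarrow> real" where
  "rademacher_sum d u S = (\<Sum>k<d. if k \<in> S then u k else - u k)"

lemma rademacher_mean_Suc:
  "rademacher_mean (Suc d) f = (rademacher_mean d f + rademacher_mean d (\<lambda>S. f (insert d S))) / 2"
proof -
  have "Pow {..<Suc d} = Pow {..<d} \<union> insert d ` Pow {..<d}"
    by (simp add: lessThan_Suc Pow_insert)
  moreover have "inj_on (insert d) (Pow {..<d})"
    by (auto simp: inj_on_def)
  moreover have "Pow {..<d} \<inter> insert d ` Pow {..<d} = {}" by auto
  ultimately have "(\<Sum>S \<in> Pow {..<Suc d}. f S) = (\<Sum>S \<in> Pow {..<d}. f S) + (\<Sum>S \<in> Pow {..<d}. f (insert d S))"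
    by (simp add: sum.union_disjoint sum.reindex o_def)
  then show ?thesis by (simp add: rademacher_mean_def field_simps)
qed

lemma rademacher_mean_cong:
  "(\<And>S. S \<subseteq> {..<d} \<Longrightarrow> f S = g S) \<Longrightarrow> rademacher_mean d f = rademacher_mean d g"
  by (auto simp: rademacher_mean_def intro!: sum.cong)

lemma rademacher_mean_mono:
  "(\<And>S. f S \<le> g S) \<Longrightarrow> rademacher_mean d f \<le> rademacher_mean d g"
  by (auto simp: rademacher_mean_def intro!: divide_right_mono sum_mono)

lemma rademacher_mean_linear:
  "rademacher_mean d (\<lambda>S. f S + g S) = rademacher_mean d f + rademacher_mean d g"
  "rademacher_mean d (\<lambda>S. c * f S) = c * rademacher_mean d f"
  "rademacher_mean d (\<lambda>S. c) = c"
  by (simp_all add: rademacher_mean_def sum.distrib add_divide_distrib sum_distrib_left card_Pow)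

lemma rademacher_mean_sum:
  "rademacher_mean d (\<lambda>S. \<Sum>i\<in>I. f i S) = (\<Sum>i\<in>I. rademacher_mean d (f i))"
  unfolding rademacher_mean_def sum_divide_distrib[symmetric] by (subst sum.swap) simp

lemma rademacher_sum_Suc:
  assumes "S \<subseteq> {..<d}"
  shows "rademacher_sum (Suc d) u S = rademacher_sum d u S - u d"
    and "rademacher_sum (Suc d) u (insert d S) = rademacher_sum d u S + u d"
proof -
  have "d \<notin> S" using assms by auto
  then show "rademacher_sum (Suc d) u S = rademacher_sum d u S - u d"
    by (simp add: rademacher_sum_def)
  have "(\<Sum>k<d. if k = d \<or> k \<in> S then u k else - u k) = (\<Sum>k<d. if k \<in> S then u k else - u k)"
    by (intro sum.cong) auto
  then show "rademacher_sum (Suc d) u (insert d S) = rademacher_sum d u S + u d"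
    by (simp add: rademacher_sum_def)
qed

lemma rademacher_mean_Suc_sums:
  "rademacher_mean (Suc d) (\<lambda>S. F (rademacher_sum (Suc d) u S) (rademacher_sum (Suc d) v S))
   = rademacher_mean d (\<lambda>S. (F (rademacher_sum d u S - u d) (rademacher_sum d v S - v d)
       + F (rademacher_sum d u S + u d) (rademacher_sum d v S + v d)) / 2)"
proof -
  have "rademacher_mean d (\<lambda>S. F (rademacher_sum (Suc d) u S) (rademacher_sum (Suc d) v S))
      = rademacher_mean d (\<lambda>S. F (rademacher_sum d u S - u d) (rademacher_sum d v S - v d))"
    by (intro rademacher_mean_cong) (simp add: rademacher_sum_Suc)
  moreover have "rademacher_mean d (\<lambda>S. F (rademacher_sum (Suc d) u (insert d S)) (rademacher_sum (Suc d) v (insert d S)))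
      = rademacher_mean d (\<lambda>S. F (rademacher_sum d u S + u d) (rademacher_sum d v S + v d))"
    by (intro rademacher_mean_cong) (simp add: rademacher_sum_Suc)
  ultimately show ?thesis
    using rademacher_mean_linear(2)[of d "1/2"]
    by (simp add: rademacher_mean_Suc rademacher_mean_linear(1))
qed

text \<open>
  The Rademacher sums embed the Euclidean space of dimension \<open>d\<close> isometrically into \<open>L\<^sup>2\<close>, because
  distinct signs are uncorrelated.
\<close>

lemma rademacher_isometry:
  "rademacher_mean d (\<lambda>S. rademacher_sum d u S * rademacher_sum d v S) = (\<Sum>k<d. u k * v k)"
proof (induction d)
  case 0
  then show ?case by (simp add: rademacher_sum_def rademacher_mean_linear)
next
  case (Suc d)
  have eq: "((U - a) * (V - b) + (U + a) * (V + b)) / 2 = U * V + a * b" for U V a b :: real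
    by (simp add: field_simps)
  show ?case
    using Suc by (simp only: rademacher_mean_Suc_sums[where F = "(*)"] eq rademacher_mean_linear sum.lessThan_Suc)
qed

text \<open>
  Khinchin's inequality for the fourth moment. Adding one sign contributes the cross term
  \<open>6 a\<^sup>2 E U\<^sup>2\<close>, which the square of the variance absorbs with the constant 3.
\<close>

lemma rademacher_fourth_moment:
  "rademacher_mean d (\<lambda>S. rademacher_sum d u S ^ 4) \<le> 3 * (\<Sum>k<d. (u k)^2)^2"
proof (induction d)
  case 0
  then show ?case by (simp add: rademacher_sum_def rademacher_mean_linear)
next
  case (Suc d)
  let ?s = "\<Sum>k<d. (u k)^2"
  have iso: "rademacher_mean d (\<lambda>S. rademacher_sum d u S ^ 2) = ?s"
    using rademacher_isometry[of d u u] by (simp add: power2_eq_square)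
  have eq: "((U - a) ^ 4 + (U + a) ^ 4) / 2 = U ^ 4 + (6 * a^2) * U^2 + a^4" for U a :: real
    by (simp add: power4_eq_xxxx power2_eq_square field_simps)
  have "rademacher_mean (Suc d) (\<lambda>S. rademacher_sum (Suc d) u S ^ 4)
      = rademacher_mean d (\<lambda>S. rademacher_sum d u S ^ 4) + (6 * (u d)^2) * ?s + u d ^ 4"
    by (simp only: rademacher_mean_Suc_sums[where F = "\<lambda>x y. x^4"] eq rademacher_mean_linear iso)
  also have "\<dots> \<le> 3 * ?s^2 + (6 * (u d)^2) * ?s + u d ^ 4" using Suc by simp
  also have "\<dots> \<le> 3 * (?s + (u d)^2)^2"
    using zero_le_power2[of "(u d)^2"] by (simp add: power2_eq_square power4_eq_xxxx algebra_simps)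
  finally show ?case by simp
qed

text \<open>
  The dimension \<open>d\<close> is quantified inside the definition: the proof of Grothendieck's inequality
  replaces the given vectors by random variables, which live in a space of higher dimension.
\<close>

definition hilbert_bound :: "nat \<Rightarrow> (nat \<Rightarrow> nat \<Rightarrow> real) \<Rightarrow> real \<Rightarrow> bool" where
  "hilbert_bound n M S \<longleftrightarrow> (\<forall>(d::nat) u v.
     (\<forall>i<n. (\<Sum>k<d. (u i k)^2) \<le> 1) \<longrightarrow> (\<forall>j<n. (\<Sum>k<d. (v j k)^2) \<le> 1) \<longrightarrow>
     (\<Sum>i<n. \<Sum>j<n. M i j * (\<Sum>k<d. u i k * v j k)) \<le> S)"

text \<open>
  Random variables on the sign space with second moments at most \<open>a\<^sup>2\<close> and \<open>b\<^sup>2\<close> are, after scaling,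
  vectors of a Euclidean unit ball of dimension \<open>2 ^ d\<close>.
\<close>

lemma hilbert_bound_rademacher:
  assumes S: "hilbert_bound n M S" and a: "a > 0" and b: "b > 0"
    and U: "\<And>i. i < n \<Longrightarrow> rademacher_mean d (\<lambda>s. (U i s)^2) \<le> a^2"
    and V: "\<And>j. j < n \<Longrightarrow> rademacher_mean d (\<lambda>s. (V j s)^2) \<le> b^2"
  shows "(\<Sum>i<n. \<Sum>j<n. M i j * rademacher_mean d (\<lambda>s. U i s * V j s)) \<le> a * b * S"
proof -
  define N where "N = card (Pow {..<d})"
  have N: "N = 2 ^ d" by (simp add: N_def card_Pow)
  obtain h where h: "bij_betw h {0..<N} (Pow {..<d})"
    using ex_bij_betw_nat_finite[of "Pow {..<d}"] by (auto simp: N_def)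
  have mean: "rademacher_mean d f = (\<Sum>k<N. f (h k)) / N" for f
    using sum.reindex_bij_betw[OF h, of f] by (simp add: rademacher_mean_def N lessThan_atLeast0)
  define u where "u i k = U i (h k) / (a * sqrt N)" for i k
  define v where "v i k = V i (h k) / (b * sqrt N)" for i k
  have Npos: "N > 0" by (simp add: N)
  have 1: "(\<Sum>k<N. (u i k)^2) \<le> 1" if "i < n" for i
    using U[OF that] a Npos unfolding mean u_def
    by (simp add: power_divide power_mult_distrib sum_divide_distrib[symmetric] field_simps)
  have 2: "(\<Sum>k<N. (v i k)^2) \<le> 1" if "i < n" for i
    using V[OF that] b Npos unfolding mean v_def
    by (simp add: power_divide power_mult_distrib sum_divide_distrib[symmetric] field_simps)
  have 3: "rademacher_mean d (\<lambda>s. U i s * V j s) = a * b * (\<Sum>k<N. u i k * v j k)" for i j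
    unfolding mean u_def v_def using a b Npos
    by (simp add: sum_divide_distrib[symmetric] field_simps)
  have "(\<Sum>i<n. \<Sum>j<n. M i j * (\<Sum>k<N. u i k * v j k)) \<le> S"
    using S 1 2 unfolding hilbert_bound_def by blast
  then have "a * b * (\<Sum>i<n. \<Sum>j<n. M i j * (\<Sum>k<N. u i k * v j k)) \<le> a * b * S"
    using a b by (intro mult_left_mono) auto
  then show ?thesis unfolding 3 by (simp add: sum_distrib_left mult_ac)
qed

definition truncate :: "real \<Rightarrow> real \<Rightarrow> real" where
  "truncate T x = (if \<bar>x\<bar> \<le> T then x else 0)"

lemma truncation_error: "(x - truncate 7 x)^2 \<le> x^4 / 49"
proof (cases "\<bar>x\<bar> \<le> 7")
  case False
  then have "7^2 \<le> \<bar>x\<bar>^2" by (intro power_mono) auto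
  then have "49 * x^2 \<le> x^2 * x^2" by (intro mult_right_mono) auto
  then show ?thesis using False by (simp add: truncate_def power2_eq_square power4_eq_xxxx)
qed (simp add: truncate_def)

text \<open>
  The heart of Grothendieck's inequality. The vectors become Rademacher sums \<open>U\<close>, \<open>V\<close>, which are split
  into their truncations at level 7 and small remainders. The truncations are bounded, so for each
  realisation of the signs the cut bound applies and contributes \<open>7\<^sup>2 B\<close>. By the fourth moment bound each
  remainder has norm at most \<open>1 / 4\<close> in \<open>L\<^sup>2\<close>, since \<open>3 / 49 \<le> 1 / 16\<close>; the two terms with a
  remainder therefore cost at most \<open>S / 4\<close> each when the bound \<open>S\<close> is applied to them.
\<close>

lemma hilbert_bound_contraction:
  assumes B: "cut_bound n M B" and S: "hilbert_bound n M S"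
  shows "hilbert_bound n M (49 * B + S / 2)"
  unfolding hilbert_bound_def
proof (intro allI impI)
  fix d and u v :: "nat \<Rightarrow> nat \<Rightarrow> real"
  assume "\<forall>i<n. (\<Sum>k<d. (u i k)^2) \<le> 1" "\<forall>j<n. (\<Sum>k<d. (v j k)^2) \<le> 1"
  then have norms: "\<And>i. i < n \<Longrightarrow> (\<Sum>k<d. (u i k)^2) \<le> 1" "\<And>i. i < n \<Longrightarrow> (\<Sum>k<d. (v i k)^2) \<le> 1" by auto
  define U where "U i = rademacher_sum d (u i)" for i
  define V where "V i = rademacher_sum d (v i)" for i
  define U' where "U' i s = truncate 7 (U i s)" for i s
  define V' where "V' i s = truncate 7 (V i s)" for i s
  have sec: "rademacher_mean d (\<lambda>s. (rademacher_sum d x s)^2) = (\<Sum>k<d. (x k)^2)" for x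
    using rademacher_isometry[of d x x] by (simp add: power2_eq_square)
  have err: "rademacher_mean d (\<lambda>s. (rademacher_sum d x s - truncate 7 (rademacher_sum d x s))^2) \<le> (1/4)^2"
    if "(\<Sum>k<d. (x k)^2) \<le> 1" for x
  proof -
    have "rademacher_mean d (\<lambda>s. (rademacher_sum d x s - truncate 7 (rademacher_sum d x s))^2)
       \<le> rademacher_mean d (\<lambda>s. 1/49 * (rademacher_sum d x s)^4)"
      by (intro rademacher_mean_mono) (use truncation_error in simp)
    also have "\<dots> \<le> 1/49 * (3 * (\<Sum>k<d. (x k)^2)^2)"
      unfolding rademacher_mean_linear by (intro mult_left_mono rademacher_fourth_moment) simp
    also have "\<dots> \<le> 1/49 * (3 * 1)"
      using that by (intro mult_left_mono power_le_one sum_nonneg) auto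
    also have "\<dots> \<le> (1/4)^2" by (simp add: power2_eq_square)
    finally show ?thesis .
  qed
  have "(\<Sum>i<n. \<Sum>j<n. M i j * rademacher_mean d (\<lambda>s. (U i s - U' i s) * V j s)) \<le> 1/4 * 1 * S"
    by (intro hilbert_bound_rademacher[OF S]) (use norms err sec in \<open>auto simp: U_def V_def U'_def\<close>)
  moreover have "(\<Sum>i<n. \<Sum>j<n. M i j * rademacher_mean d (\<lambda>s. U' i s * (V j s - V' j s))) \<le> 1 * (1/4) * S"
  proof (intro hilbert_bound_rademacher[OF S])
    show "rademacher_mean d (\<lambda>s. (U' i s)^2) \<le> 1^2" if "i < n" for i
    proof -
      have "rademacher_mean d (\<lambda>s. (U' i s)^2) \<le> rademacher_mean d (\<lambda>s. (U i s)^2)"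
        by (intro rademacher_mean_mono) (simp add: U'_def truncate_def)
      also have "\<dots> \<le> 1" using norms(1)[OF that] by (simp add: U_def sec)
      finally show ?thesis by simp
    qed
  qed (use norms err in \<open>auto simp: V_def V'_def\<close>)
  moreover have "(\<Sum>i<n. \<Sum>j<n. M i j * rademacher_mean d (\<lambda>s. U' i s * V' j s)) \<le> 49 * B"
  proof -
    have "(\<Sum>i<n. \<Sum>j<n. M i j * rademacher_mean d (\<lambda>s. U' i s * V' j s))
      = rademacher_mean d (\<lambda>s. \<Sum>i<n. \<Sum>j<n. M i j * (U' i s * V' j s))"
      by (simp add: rademacher_mean_sum rademacher_mean_linear(2))
    also have "\<dots> \<le> rademacher_mean d (\<lambda>s. 7^2 * B)"
      by (intro rademacher_mean_mono cut_bound_box[OF B]) (auto simp: U'_def V'_def truncate_def)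
    finally show ?thesis by (simp add: rademacher_mean_linear)
  qed
  moreover have "(\<Sum>k<d. u i k * v j k) = rademacher_mean d (\<lambda>s. (U i s - U' i s) * V j s)
      + rademacher_mean d (\<lambda>s. U' i s * (V j s - V' j s)) + rademacher_mean d (\<lambda>s. U' i s * V' j s)" for i j
    unfolding rademacher_mean_linear(1)[symmetric] rademacher_isometry[symmetric] U_def V_def
    by (intro rademacher_mean_cong) (simp add: algebra_simps)
  ultimately show "(\<Sum>i<n. \<Sum>j<n. M i j * (\<Sum>k<d. u i k * v j k)) \<le> 49 * B + S / 2"
    by (simp add: distrib_left sum.distrib)
qed

lemma hilbert_bound_trivial: "hilbert_bound n M (\<Sum>i<n. \<Sum>j<n. \<bar>M i j\<bar>)"
  unfolding hilbert_bound_def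
proof (intro allI impI sum_mono)
  fix d i j :: nat and u v :: "nat \<Rightarrow> nat \<Rightarrow> real"
  assume "\<forall>i<n. (\<Sum>k<d. (u i k)^2) \<le> 1" "\<forall>j<n. (\<Sum>k<d. (v j k)^2) \<le> (1::real)" "i \<in> {..<n}" "j \<in> {..<n}"
  then have *: "(\<Sum>k<d. (u i k)^2) \<le> 1" "(\<Sum>k<d. (v j k)^2) \<le> 1" by auto
  have "\<bar>\<Sum>k<d. u i k * v j k\<bar> \<le> (\<Sum>k<d. ((u i k)^2 + (v j k)^2) / 2)"
  proof (rule sum_abs[THEN order_trans], rule sum_mono)
    show "\<bar>u i k * v j k\<bar> \<le> ((u i k)\<^sup>2 + (v j k)\<^sup>2) / 2" for k
      using sum_squares_bound[of "\<bar>u i k\<bar>" "\<bar>v j k\<bar>"] by (simp add: abs_mult)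
  qed
  also have "\<dots> \<le> 1" using * by (simp add: sum_divide_distrib[symmetric] sum.distrib)
  finally have "\<bar>M i j\<bar> * \<bar>\<Sum>k<d. u i k * v j k\<bar> \<le> \<bar>M i j\<bar> * 1"
    by (intro mult_left_mono) auto
  then show "M i j * (\<Sum>k<d. u i k * v j k) \<le> \<bar>M i j\<bar>"
    using abs_ge_self[of "M i j * (\<Sum>k<d. u i k * v j k)"] by (simp add: abs_mult)
qed

text \<open>
  The least bound \<open>S\<close> over all dimensions is finite and is at most \<open>49 B + S / 2\<close> by the previous
  lemma.
\<close>

theorem grothendieck_inequality:
  assumes B: "cut_bound n M B"
  shows "hilbert_bound n M (98 * B)"
proof -
  define S where "S = Inf {S. hilbert_bound n M S}"
  have nonneg: "0 \<le> S" if "hilbert_bound n M S" for S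
    using that[unfolded hilbert_bound_def, rule_format, of "\<lambda>_ _. 0" 0 "\<lambda>_ _. 0"] by simp
  then have bdd: "bdd_below {S. hilbert_bound n M S}" by (auto intro!: bdd_belowI[of _ 0])
  have S: "hilbert_bound n M S"
    unfolding hilbert_bound_def
  proof (intro allI impI)
    fix d :: nat and u v :: "nat \<Rightarrow> nat \<Rightarrow> real"
    assume *: "\<forall>i<n. (\<Sum>k<d. (u i k)^2) \<le> 1" "\<forall>j<n. (\<Sum>k<d. (v j k)^2) \<le> 1"
    show "(\<Sum>i<n. \<Sum>j<n. M i j * (\<Sum>k<d. u i k * v j k)) \<le> S"
      unfolding S_def
    proof (rule cInf_greatest)
      show "{S. hilbert_bound n M S} \<noteq> {}" using hilbert_bound_trivial by blast
    next
      fix S' assume "S' \<in> {S. hilbert_bound n M S}"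
      then have "hilbert_bound n M S'" by simp
      then show "(\<Sum>i<n. \<Sum>j<n. M i j * (\<Sum>k<d. u i k * v j k)) \<le> S'"
        using * unfolding hilbert_bound_def by blast
    qed
  qed
  have "Inf {S. hilbert_bound n M S} \<le> 49 * B + S / 2"
    by (rule cInf_lower) (use hilbert_bound_contraction[OF B S] bdd in auto)
  then have "S \<le> 98 * B" unfolding S_def[symmetric] by simp
  with S show ?thesis by (force simp: hilbert_bound_def)
qed

section \<open>Tail bounds for independent sums\<close>

text \<open>
  For negative \<open>x = -y\<close> the claim follows from the quadratic lower bound on \<open>exp y\<close>.
\<close>

lemma exp_le_quadratic:
  fixes x :: real
  assumes "\<bar>x\<bar> \<le> 1"
  shows "exp x \<le> 1 + x + x^2"
proof (cases "x \<ge> 0")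
  case True
  then show ?thesis using exp_bound[of x] assms by simp
next
  case False
  define y where "y = - x"
  have y: "0 \<le> y" using False by (simp add: y_def)
  have "(1 - y + y^2) * (1 + y + y^2 / 2) = 1 + (y^2 + y^3 + y^4) / 2"
    by (simp add: field_simps power2_eq_square power3_eq_cube power4_eq_xxxx)
  then have "1 \<le> (1 - y + y^2) * (1 + y + y^2 / 2)" using y by simp
  also have "\<dots> \<le> (1 - y + y^2) * exp y"
  proof (intro mult_left_mono exp_lower_Taylor_quadratic y)
    have "0 \<le> (1 - y)^2 + y" using y by simp
    also have "\<dots> = 1 - y + y^2" by (simp add: power2_eq_square algebra_simps)
    finally show "0 \<le> 1 - y + y^2" .
  qed
  finally have "exp (- y) \<le> 1 - y + y^2" by (simp add: exp_minus field_simps)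
  then show ?thesis by (simp add: y_def)
qed

lemma pmf_centered_mgf_bound:
  fixes f :: "'a \<Rightarrow> real"
  assumes fin: "finite (set_pmf p)" and f: "\<And>x. x \<in> set_pmf p \<Longrightarrow> \<bar>f x\<bar> \<le> 1"
  shows "measure_pmf.expectation p (\<lambda>x. exp (f x - measure_pmf.expectation p f))
     \<le> exp (measure_pmf.expectation p (\<lambda>x. (f x)^2))"
proof -
  define \<mu> where "\<mu> = measure_pmf.expectation p f"
  define v where "v = measure_pmf.expectation p (\<lambda>x. (f x)^2)"
  note int = integrable_measure_pmf_finite[OF fin]
  have "measure_pmf.expectation p (\<lambda>x. exp (f x - \<mu>)) = exp (- \<mu>) * measure_pmf.expectation p (\<lambda>x. exp (f x))"
    by (subst integral_mult_right_zero[symmetric]) (simp add: exp_diff exp_minus field_simps)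
  also have "\<dots> \<le> exp (- \<mu>) * measure_pmf.expectation p (\<lambda>x. 1 + f x + (f x)^2)"
    by (intro mult_left_mono integral_mono_AE int) (auto simp: AE_measure_pmf_iff intro!: exp_le_quadratic f)
  also have "measure_pmf.expectation p (\<lambda>x. 1 + f x + (f x)^2) = 1 + \<mu> + v"
    by (simp add: int \<mu>_def v_def)
  also have "exp (- \<mu>) * (1 + \<mu> + v) \<le> exp (- \<mu>) * exp (\<mu> + v)"
    using exp_ge_add_one_self[of "\<mu> + v"] by (intro mult_left_mono) (auto simp: add.assoc)
  also have "\<dots> = exp v" by (simp add: exp_add[symmetric])
  finally show ?thesis by (simp add: \<mu>_def v_def)
qed

text \<open>
  The exponential Markov inequality at parameter 1. The second moments in the exponent make this a
  bound of Bernstein type: applied to scaled functions, it sees the variance of the summands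
  and not merely their range, which is what sparse graphs require.
\<close>

lemma Pi_pmf_sum_tail:
  fixes f :: "'a \<Rightarrow> 'b \<Rightarrow> real"
  assumes A: "finite A" and fin: "\<And>x. x \<in> A \<Longrightarrow> finite (set_pmf (p x))"
    and f: "\<And>x y. x \<in> A \<Longrightarrow> y \<in> set_pmf (p x) \<Longrightarrow> \<bar>f x y\<bar> \<le> 1"
  shows "measure_pmf.prob (Pi_pmf A d p)
       {y. t \<le> (\<Sum>x\<in>A. f x (y x) - measure_pmf.expectation (p x) (f x))}
     \<le> exp ((\<Sum>x\<in>A. measure_pmf.expectation (p x) (\<lambda>v. (f x v)^2)) - t)"
proof -
  define g where "g x v = f x v - measure_pmf.expectation (p x) (f x)" for x v
  have "finite (set_pmf (Pi_pmf A d p))"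
    using A fin by (auto simp: set_Pi_pmf intro!: finite_PiE_dflt)
  note int = integrable_measure_pmf_finite[OF this]
  have "measure_pmf.prob (Pi_pmf A d p) {y. t \<le> (\<Sum>x\<in>A. g x (y x))}
      = measure_pmf.prob (Pi_pmf A d p) {y \<in> space (measure_pmf (Pi_pmf A d p)). exp t \<le> exp (\<Sum>x\<in>A. g x (y x))}"
    by simp
  also have "\<dots> \<le> measure_pmf.expectation (Pi_pmf A d p) (\<lambda>y. exp (\<Sum>x\<in>A. g x (y x))) / exp t"
    by (rule integral_Markov_inequality_measure[where A = UNIV]) (auto intro: int)
  also have "measure_pmf.expectation (Pi_pmf A d p) (\<lambda>y. exp (\<Sum>x\<in>A. g x (y x)))
      = (\<Prod>x\<in>A. measure_pmf.expectation (p x) (\<lambda>v. exp (g x v)))"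
    unfolding exp_sum[OF A]
    by (rule expectation_prod_Pi_pmf) (auto intro!: A integrable_measure_pmf_finite fin)
  also have "\<dots> \<le> (\<Prod>x\<in>A. exp (measure_pmf.expectation (p x) (\<lambda>v. (f x v)^2)))"
    unfolding g_def by (intro prod_mono conjI pmf_centered_mgf_bound integral_nonneg_AE fin f) auto
  also have "\<dots> = exp (\<Sum>x\<in>A. measure_pmf.expectation (p x) (\<lambda>v. (f x v)^2))"
    by (simp add: exp_sum[OF A])
  finally show ?thesis by (simp add: g_def exp_diff divide_right_mono)
qed

text \<open>
  For two-stage experiments: \<open>B\<close> collects the bad outcomes of the first stage.
\<close>

lemma prob_bind_pmf_le:
  assumes "\<And>x. x \<in> set_pmf p \<Longrightarrow> x \<notin> B \<Longrightarrow> measure_pmf.prob (f x) E \<le> \<delta>" and "\<delta> \<ge> 0"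
  shows "measure_pmf.prob (bind_pmf p f) E \<le> measure_pmf.prob p B + \<delta>"
proof -
  have "emeasure (bind_pmf p f) E = (\<integral>\<^sup>+ x. emeasure (f x) E \<partial>p)" by simp
  also have "\<dots> \<le> (\<integral>\<^sup>+ x. indicator B x + ennreal \<delta> \<partial>p)"
  proof (intro nn_integral_mono_AE, simp add: AE_measure_pmf_iff, intro ballI)
    fix x assume x: "x \<in> set_pmf p"
    show "emeasure (f x) E \<le> indicator B x + ennreal \<delta>"
    proof (cases "x \<in> B")
      case True
      have "emeasure (f x) E \<le> 1" by (rule measure_pmf.emeasure_le_1)
      also have "\<dots> \<le> indicator B x + ennreal \<delta>" using True by simp
      finally show ?thesis .
    next
      case False
      then show ?thesis using assms x
        by (simp add: measure_pmf.emeasure_eq_measure ennreal_leI)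
    qed
  qed
  also have "\<dots> = ennreal (measure_pmf.prob p B + \<delta>)"
    using assms(2) by (simp add: nn_integral_add measure_pmf.emeasure_eq_measure)
  finally show ?thesis
    using assms(2) by (simp add: measure_pmf.emeasure_eq_measure del: ennreal_plus)
qed

lemma strict_pairs_Suc:
  "{(i, j). i < j \<and> j < Suc n} = {(i, j). i < j \<and> j < n} \<union> (\<lambda>i. (i, n)) ` {..<n}"
  by (auto simp: less_Suc_eq)

lemma finite_strict_pairs: "finite {(i, j). i < j \<and> j < (n::nat)}"
  by (rule finite_subset[of _ "{..<n} \<times> {..<n}"]) auto

lemma sum_square_eq_strict_pairs:
  fixes g :: "nat \<Rightarrow> nat \<Rightarrow> real"
  shows "(\<Sum>i<n. \<Sum>j<n. g i j) = (\<Sum>i<n. g i i) + (\<Sum>(i, j) \<in> {(i, j). i < j \<and> j < n}. g i j + g j i)"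
proof (induction n)
  case (Suc n)
  have "(\<Sum>(i, j) \<in> {(i, j). i < j \<and> j < Suc n}. g i j + g j i)
      = (\<Sum>(i, j) \<in> {(i, j). i < j \<and> j < n}. g i j + g j i) + (\<Sum>(i, j) \<in> (\<lambda>i. (i, n)) ` {..<n}. g i j + g j i)"
    unfolding strict_pairs_Suc using finite_strict_pairs by (intro sum.union_disjoint) auto
  also have "(\<Sum>(i, j) \<in> (\<lambda>i. (i, n)) ` {..<n}. g i j + g j i) = (\<Sum>i<n. g i n + g n i)"
    by (subst sum.reindex) (auto simp: inj_on_def)
  finally show ?case using Suc by (simp add: sum.distrib)
qed simp

lemma weak_pairs_eq:
  "{(i, j). i \<le> j \<and> j < n} = (\<lambda>i. (i, i)) ` {..<n} \<union> {(i, j). i < j \<and> j < (n::nat)}"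
  by auto

lemma finite_weak_pairs: "finite {(i, j). i \<le> j \<and> j < (n::nat)}"
  by (simp add: weak_pairs_eq finite_strict_pairs)

text \<open>
  Rewrites a double sum over all entries of a matrix in terms of the pairs \<open>i \<le> j\<close> that carry the
  independent draws.
\<close>

lemma sum_square_eq_weak_pairs:
  fixes g :: "nat \<Rightarrow> nat \<Rightarrow> real"
  shows "(\<Sum>i<n. \<Sum>j<n. g i j) = (\<Sum>(i, j) \<in> {(i, j). i \<le> j \<and> j < n}. if i = j then g i i else g i j + g j i)"
proof -
  have "(\<Sum>(i, j) \<in> {(i, j). i \<le> j \<and> j < n}. if i = j then g i i else g i j + g j i)
    = (\<Sum>(i, j) \<in> (\<lambda>i. (i, i)) ` {..<n}. if i = j then g i i else g i j + g j i)
      + (\<Sum>(i, j) \<in> {(i, j). i < j \<and> j < n}. if i = j then g i i else g i j + g j i)"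
    unfolding weak_pairs_eq using finite_strict_pairs by (intro sum.union_disjoint) auto
  also have "(\<Sum>(i, j) \<in> (\<lambda>i. (i, i)) ` {..<n}. if i = j then g i i else g i j + g j i) = (\<Sum>i<n. g i i)"
    by (subst sum.reindex) (auto simp: inj_on_def)
  also have "(\<Sum>(i, j) \<in> {(i, j). i < j \<and> j < n}. if i = j then g i i else g i j + g j i)
     = (\<Sum>(i, j) \<in> {(i, j). i < j \<and> j < n}. g i j + g j i)"
    by (intro sum.cong) auto
  finally show ?thesis by (simp add: sum_square_eq_strict_pairs)
qed

section \<open>The cut norm of the noise of a random graph\<close>

lemma finite_signs: "finite ({..<n::nat} \<rightarrow>\<^sub>E {-1, 1::real})"
  by (intro finite_PiE) auto

lemma card_signs: "card ({..<n::nat} \<rightarrow>\<^sub>E {-1, 1::real}) = 2 ^ n"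
  by (simp add: card_PiE numeral_2_eq_2[symmetric])

text \<open>
  For fixed signs \<open>s\<close>, \<open>t\<close> the bilinear form is a sum of independent centred variables, one for each
  pair \<open>i < j\<close>, of size at most 2 and with total variance at most \<open>2 n\<^sup>2 \<rho>\<close>. At the
  scale \<open>n sqrt (n \<rho>)\<close> of the threshold, the parameter \<open>\<eta>\<close> of order \<open>1 / sqrt (n \<rho>)\<close> in the exponential
  tail bound yields \<open>exp (- (2 + x) n)\<close> for each pair of sign vectors, and \<open>exp (2 n)\<close> exceeds their number
  \<open>4 ^ n\<close>. The condition \<open>n \<rho> \<ge> 1\<close> keeps the scaled summands bounded by 1. The spectral norm admits no such
  estimate: a single vertex of high degree can make it much larger than \<open>sqrt (n \<rho>)\<close>.
\<close>

lemma cut_bound_random_graph: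
  fixes P :: "real mat" and \<rho> x :: real
  assumes sym: "\<And>i j. i < n \<Longrightarrow> j < n \<Longrightarrow> P $$ (i, j) = P $$ (j, i)"
    and P01: "\<And>i j. i < n \<Longrightarrow> j < n \<Longrightarrow> 0 \<le> P $$ (i, j) \<and> P $$ (i, j) \<le> 1"
    and diag: "\<And>i. i < n \<Longrightarrow> P $$ (i, i) = 0"
    and dens: "(\<Sum>i<n. \<Sum>j<n. P $$ (i, j)) \<le> real n ^ 2 * \<rho>"
    and n\<rho>: "real n * \<rho> \<ge> 1" and n: "n \<ge> 1" and x: "x \<ge> 0"
  shows "measure_pmf.prob (graph_pmf n P)
     {A. \<not> cut_bound n (\<lambda>i j. P $$ (i, j) - A $$ (i, j)) ((5 + 2 * x) * real n * sqrt (real n * \<rho>))}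
     \<le> exp (- x)"
proof -
  define D where "D = {(i, j). i < j \<and> j < n}"
  define signs where "signs = {..<n} \<rightarrow>\<^sub>E {-1, 1::real}"
  define \<eta> where "\<eta> = 1 / (2 * sqrt (real n * \<rho>))"
  define \<tau> where "\<tau> = (5 + 2 * x) * real n / 2"
  define Q where "Q = Pi_pmf D False (\<lambda>(i, j). bernoulli_pmf (P $$ (i, j)))"
  define adj where "adj e = Matrix.mat n n (\<lambda>(i, j). if i = j then 0 else of_bool (e (min i j, max i j)) :: real)"
    for e :: "nat \<times> nat \<Rightarrow> bool"
  define f where "f s t k e = \<eta> * ((P $$ k - of_bool e) * (s (fst k) * t (snd k) + s (snd k) * t (fst k)))"
    for s t :: "nat \<Rightarrow> real" and k and e
  have \<eta>: "\<eta> > 0" "\<eta> \<le> 1 / 2" "\<eta>^2 = 1 / (4 * (real n * \<rho>))"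
    using n\<rho> by (auto simp: \<eta>_def power_divide field_simps)
  have D: "finite D" unfolding D_def by (rule finite_strict_pairs)
  have Dn: "fst k < n" "snd k < n" "fst k < snd k" if "k \<in> D" for k
    using that by (auto simp: D_def)
  have PD: "0 \<le> P $$ k" "P $$ k \<le> 1" if "k \<in> D" for k
    using that P01[of "fst k" "snd k"] Dn[OF that] by auto
  have Y: "\<bar>s (fst k) * t (snd k) + s (snd k) * t (fst k)\<bar> \<le> 2" if "s \<in> signs" "t \<in> signs" "k \<in> D" for s t k
  proof -
    have "s i \<in> {-1, 1}" "t i \<in> {-1, 1}" if "i < n" for i
      using \<open>s \<in> signs\<close> \<open>t \<in> signs\<close> that by (auto simp: signs_def PiE_iff)
    from this(1)[of "fst k"] this(1)[of "snd k"] this(2)[of "fst k"] this(2)[of "snd k"] Dn[OF that(3)]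
    show ?thesis by auto
  qed
  have form: "(\<Sum>k\<in>D. f s t k (e k)) = \<eta> * (\<Sum>i<n. \<Sum>j<n. (P $$ (i, j) - adj e $$ (i, j)) * (s i * t j))" for s t e
  proof -
    have "(\<Sum>i<n. \<Sum>j<n. (P $$ (i, j) - adj e $$ (i, j)) * (s i * t j))
       = (\<Sum>(i, j)\<in>D. (P $$ (i, j) - adj e $$ (i, j)) * (s i * t j) + (P $$ (j, i) - adj e $$ (j, i)) * (s j * t i))"
      unfolding sum_square_eq_strict_pairs D_def[symmetric] by (simp add: diag adj_def)
    also have "\<eta> * \<dots> = (\<Sum>k\<in>D. f s t k (e k))"
      unfolding sum_distrib_left
    proof (intro sum.cong refl)
      fix k assume "k \<in> D"
      then show "\<eta> * (case k of (i, j) \<Rightarrow> (P $$ (i, j) - adj e $$ (i, j)) * (s i * t j) + (P $$ (j, i) - adj e $$ (j, i)) * (s j * t i)) = f s t k (e k)"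
        using sym[of "snd k" "fst k"] by (auto simp: f_def adj_def D_def min_def max_def algebra_simps)
    qed
    finally show ?thesis by simp
  qed
  have tail: "measure_pmf.prob Q {e. \<tau> \<le> (\<Sum>k\<in>D. f s t k (e k))} \<le> exp (real n / 2 - \<tau>)"
    if st: "s \<in> signs" "t \<in> signs" for s t
  proof -
    let ?p = "\<lambda>k. bernoulli_pmf (P $$ k)"
    have mean: "measure_pmf.expectation (?p k) (f s t k) = 0" if "k \<in> D" for k
      using PD[OF that] by (simp add: f_def algebra_simps)
    have sq: "measure_pmf.expectation (?p k) (\<lambda>e. (f s t k e)^2) \<le> 4 * \<eta>^2 * P $$ k" if "k \<in> D" for k
    proof -
      let ?Y = "s (fst k) * t (snd k) + s (snd k) * t (fst k)"
      have "measure_pmf.expectation (?p k) (\<lambda>e. (f s t k e)^2) = \<eta>^2 * ?Y^2 * (P $$ k * (1 - P $$ k))"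
        using PD[OF that] by (simp add: f_def power_mult_distrib) (simp add: power2_eq_square algebra_simps)
      also have "\<dots> \<le> \<eta>^2 * 2^2 * (P $$ k * 1)"
        using power_mono[OF Y[OF st that], of 2] PD[OF that] by (intro mult_mono) auto
      finally show ?thesis by simp
    qed
    have bound: "\<bar>f s t k e\<bar> \<le> 1" if "k \<in> D" for k e
    proof -
      have "\<bar>f s t k e\<bar> \<le> (1 / 2) * (1 * 2)"
        unfolding f_def abs_mult using \<eta> PD[OF that] Y[OF st that] by (intro mult_mono) auto
      then show ?thesis by simp
    qed
    have "measure_pmf.prob Q {e. \<tau> \<le> (\<Sum>k\<in>D. f s t k (e k))}
        = measure_pmf.prob (Pi_pmf D False ?p) {e. \<tau> \<le> (\<Sum>k\<in>D. f s t k (e k) - measure_pmf.expectation (?p k) (f s t k))}"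
    proof -
      have "(\<Sum>k\<in>D. f s t k (e k)) = (\<Sum>k\<in>D. f s t k (e k) - measure_pmf.expectation (?p k) (f s t k))" for e
        by (intro sum.cong) (auto simp: mean)
      moreover have "Q = Pi_pmf D False ?p"
        unfolding Q_def by (intro Pi_pmf_cong) auto
      ultimately show ?thesis by simp
    qed
    also have "\<dots> \<le> exp ((\<Sum>k\<in>D. measure_pmf.expectation (?p k) (\<lambda>e. (f s t k e)^2)) - \<tau>)"
      by (intro Pi_pmf_sum_tail D bound) auto
    also have "\<dots> \<le> exp (real n / 2 - \<tau>)"
    proof -
      have "2 * (\<Sum>k\<in>D. P $$ k) = (\<Sum>(i, j)\<in>D. P $$ (i, j) + P $$ (j, i))"
        unfolding sum_distrib_left by (intro sum.cong) (auto simp: D_def sym)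
      also have "\<dots> = (\<Sum>i<n. \<Sum>j<n. P $$ (i, j))"
        unfolding sum_square_eq_strict_pairs D_def by (simp add: diag)
      finally have half: "(\<Sum>k\<in>D. P $$ k) \<le> real n ^ 2 * \<rho> / 2" using dens by linarith
      have "(\<Sum>k\<in>D. measure_pmf.expectation (?p k) (\<lambda>e. (f s t k e)^2)) \<le> (\<Sum>k\<in>D. 4 * \<eta>^2 * P $$ k)"
        by (intro sum_mono sq)
      also have "\<dots> = 4 * \<eta>^2 * (\<Sum>k\<in>D. P $$ k)" by (simp add: sum_distrib_left)
      also have "\<dots> \<le> 4 * \<eta>^2 * (real n ^ 2 * \<rho> / 2)" by (intro mult_left_mono half) simp
      also have "\<dots> = real n / 2" using n\<rho> unfolding \<eta>(3) by (auto simp: field_simps power2_eq_square)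
      finally show ?thesis by simp
    qed
    finally show ?thesis .
  qed
  have "measure_pmf.prob (graph_pmf n P)
      {A. \<not> cut_bound n (\<lambda>i j. P $$ (i, j) - A $$ (i, j)) ((5 + 2 * x) * real n * sqrt (real n * \<rho>))}
     = measure_pmf.prob Q
      {e. \<not> cut_bound n (\<lambda>i j. P $$ (i, j) - adj e $$ (i, j)) ((5 + 2 * x) * real n * sqrt (real n * \<rho>))}"
    by (simp add: graph_pmf_def Q_def D_def adj_def vimage_def)
  also have "\<dots> \<le> measure_pmf.prob Q (\<Union>(s, t) \<in> signs \<times> signs. {e. \<tau> \<le> (\<Sum>k\<in>D. f s t k (e k))})"
  proof (intro measure_pmf.finite_measure_mono subsetI, goal_cases)
    case (1 e)
    then obtain s t where st: "s \<in> signs" "t \<in> signs"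
      "(5 + 2 * x) * real n * sqrt (real n * \<rho>) < (\<Sum>i<n. \<Sum>j<n. (P $$ (i, j) - adj e $$ (i, j)) * (s i * t j))"
      by (auto simp: cut_bound_def signs_def not_le)
    have "\<tau> = \<eta> * ((5 + 2 * x) * real n * sqrt (real n * \<rho>))"
      using n\<rho> by (auto simp: \<tau>_def \<eta>_def)
    also have "\<dots> \<le> (\<Sum>k\<in>D. f s t k (e k))"
      unfolding form using st(3) \<eta>(1) by (intro mult_left_mono) auto
    finally show ?case using st by auto
  qed auto
  also have "\<dots> \<le> (\<Sum>(s, t) \<in> signs \<times> signs. measure_pmf.prob Q {e. \<tau> \<le> (\<Sum>k\<in>D. f s t k (e k))})"
    unfolding case_prod_beta
    by (intro measure_pmf.finite_measure_subadditive_finite) (auto simp: signs_def finite_signs)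
  also have "\<dots> \<le> (\<Sum>(s, t) \<in> signs \<times> signs. exp (real n / 2 - \<tau>))"
    by (intro sum_mono) (auto intro: tail)
  also have "\<dots> = 4 ^ n * exp (real n / 2 - \<tau>)"
    by (simp add: signs_def card_signs card_cartesian_product power_mult_distrib[symmetric])
  also have "\<dots> \<le> exp 2 ^ n * exp (real n / 2 - \<tau>)"
    using exp_lower_Taylor_quadratic[of 2] by (intro mult_right_mono power_mono) auto
  also have "\<dots> = exp (- (real n * x))"
    by (simp add: exp_of_nat_mult[symmetric] exp_add[symmetric] \<tau>_def algebra_simps)
  also have "\<dots> \<le> exp (- x)" using n x mult_right_mono[of 1 "real n" x] by simp
  finally show ?thesis .
qed

section \<open>Likelihood scores of admissible parameters\<close>

text \<open>
  Log-odds of the parameter relative to the density: in an admissible model these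
  are at most \<open>ln c\<close> in absolute value, however sparse the graph.
\<close>

definition log_odds_ratio :: "real mat \<Rightarrow> real \<Rightarrow> nat \<times> nat \<Rightarrow> real" where
  "log_odds_ratio \<theta> \<rho> v = ln (\<theta> $$ v / (1 - \<theta> $$ v)) - ln \<rho>"

text \<open>
  The log-likelihood of a pair of classes, up to the summand \<open>p * ln \<rho>\<close> common to all pairs.
\<close>

definition score :: "real mat \<Rightarrow> real \<Rightarrow> real \<Rightarrow> nat \<times> nat \<Rightarrow> real" where
  "score \<theta> \<rho> p v = p * log_odds_ratio \<theta> \<rho> v + ln (1 - \<theta> $$ v)"

definition expected_score :: "nat \<Rightarrow> nat \<Rightarrow> real mat \<Rightarrow> real \<Rightarrow> real mat \<Rightarrow> real mat \<Rightarrow> real" where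
  "expected_score n K \<theta> \<rho> B X =
     (\<Sum>i<n. \<Sum>j<n. \<Sum>a<K. \<Sum>b<K. score \<theta> \<rho> (B $$ (i, j)) (a, b) * X $$ (i * K + a, j * K + b))"

text \<open>
  The part of the divergence from \<open>p\<close> that is the same for all pairs of classes.
\<close>

definition entropy_part :: "real \<Rightarrow> real \<Rightarrow> real" where
  "entropy_part \<rho> p = p * ln p + (1 - p) * ln (1 - p) - p * ln \<rho>"

lemma KL_eq_entropy_part_minus_score:
  assumes "0 \<le> p" "p \<le> 1" "0 < \<theta> $$ v" "\<theta> $$ v < 1"
  shows "KL p (\<theta> $$ v) = entropy_part \<rho> p - score \<theta> \<rho> p v"
proof -
  have "p * ln (p / \<theta> $$ v) = p * ln p - p * ln (\<theta> $$ v)"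
    using assms by (cases "p = 0") (auto simp: ln_div algebra_simps)
  moreover have "(1 - p) * ln ((1 - p) / (1 - \<theta> $$ v)) = (1 - p) * ln (1 - p) - (1 - p) * ln (1 - \<theta> $$ v)"
    using assms by (cases "p = 1") (auto simp: ln_div algebra_simps)
  ultimately show ?thesis
    using assms by (simp add: KL_def score_def log_odds_ratio_def entropy_part_def ln_div algebra_simps)
qed

lemma log_likelihood_eq_score:
  assumes "0 < \<theta> $$ v" "\<theta> $$ v < 1"
  shows "p * ln (\<theta> $$ v) + (1 - p) * ln (1 - \<theta> $$ v) = p * ln \<rho> + score \<theta> \<rho> p v"
  using assms by (simp add: score_def log_odds_ratio_def ln_div algebra_simps)

lemma admissible_modelD:
  assumes adm: "admissible_model n K c P \<theta>" and n: "n \<ge> 2"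
  defines "\<rho> \<equiv> mean_density n P"
  shows "real n * \<rho> \<ge> 1" "\<rho> > 0" "\<rho> \<le> 1" "(\<Sum>i<n. \<Sum>j<n. P $$ (i, j)) \<le> real n ^ 2 * \<rho>"
    and "\<And>i j. i < n \<Longrightarrow> j < n \<Longrightarrow> P $$ (i, j) = P $$ (j, i)"
    and "\<And>i j. i < n \<Longrightarrow> j < n \<Longrightarrow> 0 \<le> P $$ (i, j) \<and> P $$ (i, j) \<le> 1"
    and "\<And>i. i < n \<Longrightarrow> P $$ (i, i) = 0"
    and "\<And>a b. a < K \<Longrightarrow> b < K \<Longrightarrow> \<theta> $$ (a, b) = \<theta> $$ (b, a)"
proof -
  show "real n * \<rho> \<ge> 1" using adm n by (simp add: admissible_model_def \<rho>_def field_simps)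
  then show pos: "\<rho> > 0"
    using n by (smt (verit, best) mult_nonneg_nonpos of_nat_0_le_iff)
  show P01: "0 \<le> P $$ (i, j) \<and> P $$ (i, j) \<le> 1" if "i < n" "j < n" for i j
    using adm that by (simp add: admissible_model_def)
  show diag: "P $$ (i, i) = 0" if "i < n" for i
    using adm that by (simp add: admissible_model_def)
  have P: "P \<in> carrier_mat n n" "P\<^sup>T = P" and \<theta>: "\<theta> \<in> carrier_mat K K" "\<theta>\<^sup>T = \<theta>"
    using adm by (auto simp: admissible_model_def symmetric_mat_def)
  show "P $$ (i, j) = P $$ (j, i)" if "i < n" "j < n" for i j
    using P that by (metis carrier_matD index_transpose_mat(1))
  show "\<theta> $$ (a, b) = \<theta> $$ (b, a)" if "a < K" "b < K" for a b
    using \<theta> that by (metis carrier_matD index_transpose_mat(1))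
  have total: "(\<Sum>i<n. \<Sum>j<n. P $$ (i, j)) = real n * (real n - 1) * \<rho>"
    using n by (simp add: \<rho>_def mean_density_def)
  also have "\<dots> \<le> real n * real n * \<rho>"
    using n pos by (intro mult_right_mono mult_left_mono) auto
  finally show "(\<Sum>i<n. \<Sum>j<n. P $$ (i, j)) \<le> real n ^ 2 * \<rho>" by (simp add: power2_eq_square)
  have "(\<Sum>j<n. P $$ (i, j)) \<le> real n - 1" if "i < n" for i
  proof -
    have "(\<Sum>j<n. P $$ (i, j)) = (\<Sum>j\<in>{..<n} - {i}. P $$ (i, j))"
      using that by (subst sum.remove[of _ i]) (auto simp: diag)
    also have "\<dots> \<le> (\<Sum>j\<in>{..<n} - {i}. 1)" using P01 that by (intro sum_mono) auto
    finally show ?thesis using that n by (simp add: of_nat_diff)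
  qed
  then have "(\<Sum>i<n. \<Sum>j<n. P $$ (i, j)) \<le> (\<Sum>i<n. real n - 1)" by (intro sum_mono) auto
  then have "real n * (real n - 1) * \<rho> \<le> real n * (real n - 1) * 1" using total by simp
  then show "\<rho> \<le> 1" using n by (subst (asm) mult_le_cancel_left_pos) auto
qed

lemma admissible_parameter_bounds:
  assumes adm: "admissible_model n K c P \<theta>" and n: "n \<ge> 2" and c: "c > 0"
    and v: "v \<in> {..<K} \<times> {..<K}"
  defines "\<rho> \<equiv> mean_density n P"
  shows "0 < \<theta> $$ v" "\<theta> $$ v < 1" "\<bar>log_odds_ratio \<theta> \<rho> v\<bar> \<le> ln c" "\<bar>ln (1 - \<theta> $$ v)\<bar> \<le> c * \<rho>"
proof -
  define r where "r = \<theta> $$ v / (1 - \<theta> $$ v)"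
  have \<rho>: "\<rho> > 0" unfolding \<rho>_def by (rule admissible_modelD[OF adm n])
  obtain a b where ab: "v = (a, b)" "a < K" "b < K" using v by auto
  have r: "\<rho> / c \<le> r" "r \<le> c * \<rho>" and \<theta>: "0 \<le> \<theta> $$ v" "\<theta> $$ v \<le> 1"
    using adm ab by (auto simp: admissible_model_def \<rho>_def r_def)
  have rpos: "r > 0" using r(1) \<rho> c by (smt (verit) divide_pos_pos)
  then show \<theta>01: "0 < \<theta> $$ v" "\<theta> $$ v < 1"
    using \<theta> by (auto simp: r_def less_le)
  have "ln (\<rho> / c) \<le> ln r" "ln r \<le> ln (c * \<rho>)"
    using r \<rho> c rpos by auto
  then show "\<bar>log_odds_ratio \<theta> \<rho> v\<bar> \<le> ln c"
    using \<rho> c by (simp add: log_odds_ratio_def r_def[symmetric] ln_div ln_mult abs_le_iff)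
  have "1 / (1 - \<theta> $$ v) = 1 + r" using \<theta>01 by (simp add: r_def field_simps)
  then have "- ln (1 - \<theta> $$ v) = ln (1 + r)"
    using \<theta>01 by (metis diff_gt_0_iff_gt ln_inverse inverse_eq_divide)
  also have "\<dots> \<le> r" using rpos by (intro ln_add_one_self_le_self) auto
  finally show "\<bar>ln (1 - \<theta> $$ v)\<bar> \<le> c * \<rho>" using r \<theta>01 by simp
qed

section \<open>The semidefinite program\<close>

lemma block_index_less: "i < n \<Longrightarrow> a < K \<Longrightarrow> i * K + a < n * (K :: nat)"
proof -
  assume "i < n" "a < K"
  then have "i * K + a < Suc i * K" by simp
  also have "\<dots> \<le> n * K" using \<open>i < n\<close> by (intro mult_le_mono1) simp
  finally show ?thesis .
qed

lemma sum_over_blocks: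
  fixes g :: "nat \<Rightarrow> real"
  shows "(\<Sum>k<n * K. g k) = (\<Sum>i<n. \<Sum>a<K. g (i * K + a))"
proof -
  have "sum g {i * K..<i * K + K} = (\<Sum>a<K. g (i * K + a))" for i
    using sum.shift_bounds_nat_ivl[of g 0 "i * K" K] by (simp add: add.commute lessThan_atLeast0)
  then show ?thesis using sum.nat_group[of g K n] by simp
qed

lemma sdp_feasibleD:
  assumes X: "X \<in> sdp_feasible n K"
  shows "X \<in> carrier_mat (n * K) (n * K)"
    and "\<And>k l. k < n * K \<Longrightarrow> l < n * K \<Longrightarrow> X $$ (k, l) = X $$ (l, k)"
    and "\<And>k l. k < n * K \<Longrightarrow> l < n * K \<Longrightarrow> 0 \<le> X $$ (k, l)"
    and "\<And>f. 0 \<le> (\<Sum>k<n * K. \<Sum>l<n * K. f k * X $$ (k, l) * f l)"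
    and "\<And>i j. i < n \<Longrightarrow> j < n \<Longrightarrow> (\<Sum>a<K. \<Sum>b<K. X $$ (i * K + a, j * K + b)) = 1"
proof -
  show C: "X \<in> carrier_mat (n * K) (n * K)"
    and "\<And>k l. k < n * K \<Longrightarrow> l < n * K \<Longrightarrow> 0 \<le> X $$ (k, l)"
    using X by (auto simp: sdp_feasible_def)
  have psd: "psd_mat X" using X by (auto simp: sdp_feasible_def)
  then have "X\<^sup>T = X" by (simp add: psd_mat_def symmetric_mat_def)
  then show "X $$ (k, l) = X $$ (l, k)" if "k < n * K" "l < n * K" for k l
    using C that by (metis carrier_matD index_transpose_mat(1))
  show "0 \<le> (\<Sum>k<n * K. \<Sum>l<n * K. f k * X $$ (k, l) * f l)" for f
  proof -
    define v where "v = Matrix.vec (n * K) f"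
    have "0 \<le> scalar_prod v (mult_mat_vec X v)"
      using psd C by (auto simp: psd_mat_def v_def)
    also have "\<dots> = (\<Sum>k<n * K. \<Sum>l<n * K. f k * X $$ (k, l) * f l)"
      using C by (simp add: scalar_prod_def v_def row_def lessThan_atLeast0 sum_distrib_left mult.assoc)
    finally show ?thesis .
  qed
  show "(\<Sum>a<K. \<Sum>b<K. X $$ (i * K + a, j * K + b)) = 1" if "i < n" "j < n" for i j
    using X that by (simp add: sdp_feasible_def block_def)
qed

lemma sdp_feasible_diag_le_1:
  assumes X: "X \<in> sdp_feasible n K" and "i < n" "a < K"
  shows "X $$ (i * K + a, i * K + a) \<le> 1"
proof -
  have nn: "0 \<le> X $$ (i * K + a', i * K + b)" if "a' < K" "b < K" for a' b
    using sdp_feasibleD(3)[OF X] block_index_less assms(2) that by blast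
  have "X $$ (i * K + a, i * K + a) \<le> (\<Sum>b<K. X $$ (i * K + a, i * K + b))"
    using nn assms by (intro member_le_sum) auto
  also have "\<dots> \<le> (\<Sum>a'<K. \<Sum>b<K. X $$ (i * K + a', i * K + b))"
    using nn assms by (intro member_le_sum[where f = "\<lambda>a'. \<Sum>b<K. X $$ (i * K + a', i * K + b)"] sum_nonneg) auto
  also have "\<dots> = 1" using sdp_feasibleD(5)[OF X] assms by simp
  finally show ?thesis .
qed

text \<open>
  Since every block of a feasible matrix has total mass 1, the terms of size \<open>ln \<rho>\<close> in the objective
  do not depend on the feasible point.
\<close>

lemma mat_inner_sdp_objective:
  assumes X: "X \<in> sdp_feasible n K"
    and \<theta>: "\<And>v. v \<in> {..<K} \<times> {..<K} \<Longrightarrow> 0 < \<theta> $$ v \<and> \<theta> $$ v < 1"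
  shows "mat_inner (sdp_objective n K A \<theta>) X
    = (\<Sum>i<n. \<Sum>j<n. A $$ (i, j)) * ln \<rho> + expected_score n K \<theta> \<rho> A X"
proof -
  let ?F = "sdp_objective n K A \<theta>"
  have F: "?F $$ (i * K + a, j * K + b) = A $$ (i, j) * ln \<rho> + score \<theta> \<rho> (A $$ (i, j)) (a, b)"
    if "i < n" "j < n" "a < K" "b < K" for i j a b
    using that \<theta>[of "(a, b)"] block_index_less[of i n a K] block_index_less[of j n b K]
    by (simp add: sdp_objective_def log_likelihood_eq_score)
  have "mat_inner ?F X = (\<Sum>k<n * K. \<Sum>l<n * K. ?F $$ (k, l) * X $$ (k, l))"
    by (simp add: mat_inner_def sdp_objective_def)
  also have "\<dots> = (\<Sum>i<n. \<Sum>a<K. \<Sum>j<n. \<Sum>b<K. ?F $$ (i * K + a, j * K + b) * X $$ (i * K + a, j * K + b))"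
    by (simp add: sum_over_blocks)
  also have "\<dots> = (\<Sum>i<n. \<Sum>j<n. \<Sum>a<K. \<Sum>b<K. ?F $$ (i * K + a, j * K + b) * X $$ (i * K + a, j * K + b))"
    by (intro sum.cong refl sum.swap)
  also have "\<dots> = (\<Sum>i<n. \<Sum>j<n. A $$ (i, j) * ln \<rho> * (\<Sum>a<K. \<Sum>b<K. X $$ (i * K + a, j * K + b))
       + (\<Sum>a<K. \<Sum>b<K. score \<theta> \<rho> (A $$ (i, j)) (a, b) * X $$ (i * K + a, j * K + b)))"
    unfolding sum_distrib_left sum.distrib[symmetric]
    by (intro sum.cong refl) (simp add: F distrib_right)
  also have "\<dots> = (\<Sum>i<n. \<Sum>j<n. A $$ (i, j) * ln \<rho>
       + (\<Sum>a<K. \<Sum>b<K. score \<theta> \<rho> (A $$ (i, j)) (a, b) * X $$ (i * K + a, j * K + b)))"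
    by (intro sum.cong refl) (simp add: sdp_feasibleD(5)[OF X])
  finally show ?thesis by (simp add: expected_score_def sum.distrib sum_distrib_right)
qed

text \<open>
  The rank-one feasible point \<open>u u\<^sup>T\<close> of a labelling, where \<open>u\<close> marks the class of each node. It makes the
  semidefinite program a relaxation of maximum likelihood.
\<close>

definition labeling_mat :: "nat \<Rightarrow> nat \<Rightarrow> (nat \<Rightarrow> nat) \<Rightarrow> real mat" where
  "labeling_mat n K z = Matrix.mat (n * K) (n * K)
     (\<lambda>(k, l). of_bool (k mod K = z (k div K)) * of_bool (l mod K = z (l div K)))"

lemma labeling_mat_entry:
  assumes "i < n" "j < n" "a < K" "b < K"
  shows "labeling_mat n K z $$ (i * K + a, j * K + b) = of_bool (a = z i) * of_bool (b = z j)"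
  using assms block_index_less[of i n a K] block_index_less[of j n b K]
  by (simp add: labeling_mat_def)

lemma sum_labeling_mat:
  fixes g :: "nat \<Rightarrow> nat \<Rightarrow> real"
  assumes z: "z \<in> {..<n} \<rightarrow> {..<K}" and ij: "i < n" "j < n"
  shows "(\<Sum>a<K. \<Sum>b<K. g a b * labeling_mat n K z $$ (i * K + a, j * K + b)) = g (z i) (z j)"
proof -
  have "z i < K" "z j < K" using z ij by auto
  have "(\<Sum>a<K. \<Sum>b<K. g a b * labeling_mat n K z $$ (i * K + a, j * K + b))
      = (\<Sum>a<K. \<Sum>b<K. if b = z j then if a = z i then g a b else 0 else 0)"
    using ij by (intro sum.cong refl) (simp add: labeling_mat_entry)
  also have "\<dots> = g (z i) (z j)" using \<open>z i < K\<close> \<open>z j < K\<close> by simp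
  finally show ?thesis .
qed

lemma labeling_mat_feasible:
  assumes z: "z \<in> {..<n} \<rightarrow> {..<K}"
  shows "labeling_mat n K z \<in> sdp_feasible n K"
proof -
  let ?X = "labeling_mat n K z"
  define u where "u k = (of_bool (k mod K = z (k div K)) :: real)" for k
  have X: "?X \<in> carrier_mat (n * K) (n * K)"
    and entry: "\<And>k l. k < n * K \<Longrightarrow> l < n * K \<Longrightarrow> ?X $$ (k, l) = u k * u l"
    by (auto simp: labeling_mat_def u_def)
  have "scalar_prod v (mult_mat_vec ?X v) = (\<Sum>k<n * K. vec_index v k * u k)^2"
    if "v \<in> carrier_vec (n * K)" for v
  proof -
    have "scalar_prod v (mult_mat_vec ?X v) = (\<Sum>k<n * K. \<Sum>l<n * K. vec_index v k * (?X $$ (k, l) * vec_index v l))"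
      using X that by (simp add: scalar_prod_def row_def lessThan_atLeast0 sum_distrib_left)
    also have "\<dots> = (\<Sum>k<n * K. \<Sum>l<n * K. (vec_index v k * u k) * (vec_index v l * u l))"
      by (intro sum.cong refl) (simp add: entry)
    finally show ?thesis by (simp add: power2_eq_square sum_product)
  qed
  then have "psd_mat ?X"
    using X entry by (auto simp: psd_mat_def symmetric_mat_def intro!: eq_matI)
  moreover have "(\<Sum>a<K. \<Sum>b<K. block K ?X i j $$ (a, b)) = 1" if "i < n" "j < n" for i j
    using sum_labeling_mat[OF z that, of "\<lambda>_ _. 1"] by (simp add: block_def)
  ultimately show ?thesis
    using X entry by (auto simp: sdp_feasible_def u_def)
qed

lemma expected_score_labeling_mat:
  assumes z: "z \<in> {..<n} \<rightarrow> {..<K}"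
  shows "expected_score n K \<theta> \<rho> B (labeling_mat n K z) = (\<Sum>i<n. \<Sum>j<n. score \<theta> \<rho> (B $$ (i, j)) (z i, z j))"
  unfolding expected_score_def
  by (intro sum.cong refl) (simp add: sum_labeling_mat[OF z])

text \<open>
  The entries of \<open>X\<close> are inner products of vectors of norm at most 1, as the diagonal blocks have
  nonnegative entries of total 1. For fixed classes \<open>a\<close>, \<open>b\<close> Grothendieck's inequality applies to these
  vectors, and once more with the second family negated.
\<close>

lemma feasible_bilinear_bound:
  assumes X: "X \<in> sdp_feasible n K" and cut: "cut_bound n M B" and ab: "a < K" "b < K"
  shows "\<bar>\<Sum>i<n. \<Sum>j<n. M i j * X $$ (i * K + a, j * K + b)\<bar> \<le> 98 * B"
proof -
  obtain w where w: "\<And>k l. k < n * K \<Longrightarrow> l < n * K \<Longrightarrow> X $$ (k, l) = (\<Sum>r<n * K. w k r * w l r)"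
    using gram_factorization[of "n * K" "\<lambda>k l. X $$ (k, l)"] sdp_feasibleD(2,4)[OF X] by blast
  have norm: "(\<Sum>r<n * K. (w (i * K + a') r)^2) \<le> 1" if "i < n" "a' < K" for i a'
    using sdp_feasible_diag_le_1[OF X that] block_index_less[OF that]
    by (simp add: w power2_eq_square)
  have "hilbert_bound n M (98 * B)" by (rule grothendieck_inequality[OF cut])
  note * = this[unfolded hilbert_bound_def, rule_format]
  have entry: "X $$ (i * K + a, j * K + b) = (\<Sum>r<n * K. w (i * K + a) r * w (j * K + b) r)" if "i < n" "j < n" for i j
    using that ab by (intro w block_index_less)
  have "(\<Sum>i<n. \<Sum>j<n. M i j * (\<Sum>r<n * K. w (i * K + a) r * w (j * K + b) r)) \<le> 98 * B"
    by (rule *) (use norm ab in auto)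
  moreover have "(\<Sum>i<n. \<Sum>j<n. M i j * (\<Sum>r<n * K. w (i * K + a) r * - w (j * K + b) r)) \<le> 98 * B"
    by (rule *) (use norm ab in auto)
  ultimately show ?thesis
    by (simp add: entry sum_negf abs_le_iff)
qed

lemma expected_score_deviation:
  assumes X: "X \<in> sdp_feasible n K" and cut: "cut_bound n (\<lambda>i j. P $$ (i, j) - A $$ (i, j)) B"
    and r: "\<And>v. v \<in> {..<K} \<times> {..<K} \<Longrightarrow> \<bar>log_odds_ratio \<theta> \<rho> v\<bar> \<le> r"
  shows "\<bar>expected_score n K \<theta> \<rho> P X - expected_score n K \<theta> \<rho> A X\<bar> \<le> 98 * real K ^ 2 * r * B"
proof -
  let ?m = "\<lambda>i j. P $$ (i, j) - A $$ (i, j)"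
  have "expected_score n K \<theta> \<rho> P X - expected_score n K \<theta> \<rho> A X
      = (\<Sum>i<n. \<Sum>j<n. \<Sum>v\<in>{..<K} \<times> {..<K}. log_odds_ratio \<theta> \<rho> v * (?m i j * X $$ (i * K + fst v, j * K + snd v)))"
    unfolding expected_score_def sum_subtractf[symmetric] sum.cartesian_product
    by (intro sum.cong refl) (auto simp: score_def algebra_simps)
  also have "\<dots> = (\<Sum>v\<in>{..<K} \<times> {..<K}. log_odds_ratio \<theta> \<rho> v * (\<Sum>i<n. \<Sum>j<n. ?m i j * X $$ (i * K + fst v, j * K + snd v)))"
    unfolding sum_distrib_left
    by (subst sum.swap, subst (2) sum.swap, subst sum.swap, subst (2) sum.swap) (rule refl)
  also have "\<bar>\<dots>\<bar> \<le> (\<Sum>v\<in>{..<K} \<times> {..<K}. r * (98 * B))"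
  proof (rule sum_abs[THEN order_trans], rule sum_mono)
    fix v assume v: "v \<in> {..<K} \<times> {..<K}"
    have "\<bar>\<Sum>i<n. \<Sum>j<n. ?m i j * X $$ (i * K + fst v, j * K + snd v)\<bar> \<le> 98 * B"
      using v by (intro feasible_bilinear_bound[OF X cut]) auto
    then show "\<bar>log_odds_ratio \<theta> \<rho> v * (\<Sum>i<n. \<Sum>j<n. ?m i j * X $$ (i * K + fst v, j * K + snd v))\<bar> \<le> r * (98 * B)"
      unfolding abs_mult using r[OF v] by (intro mult_mono) auto
  qed
  also have "\<dots> = 98 * real K ^ 2 * r * B" by (simp add: power2_eq_square)
  finally show ?thesis .
qed

text \<open>
  The usual argument for an empirical maximiser: the optimality of \<open>X\<close> holds for the data \<open>A\<close>, and passing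
  between \<open>A\<close> and \<open>P\<close> costs one uniform deviation at \<open>X\<close> and one at the labelling.
\<close>

lemma sdp_solution_near_optimal:
  assumes sol: "sdp_solution n K A \<theta> X" and cut: "cut_bound n (\<lambda>i j. P $$ (i, j) - A $$ (i, j)) B"
    and \<theta>: "\<And>v. v \<in> {..<K} \<times> {..<K} \<Longrightarrow> 0 < \<theta> $$ v \<and> \<theta> $$ v < 1"
    and r: "\<And>v. v \<in> {..<K} \<times> {..<K} \<Longrightarrow> \<bar>log_odds_ratio \<theta> \<rho> v\<bar> \<le> r"
    and z: "z \<in> {..<n} \<rightarrow> {..<K}"
  shows "(\<Sum>i<n. \<Sum>j<n. score \<theta> \<rho> (P $$ (i, j)) (z i, z j))
      \<le> expected_score n K \<theta> \<rho> P X + 196 * real K ^ 2 * r * B"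
proof -
  let ?Z = "labeling_mat n K z"
  have X: "X \<in> sdp_feasible n K" and opt: "\<And>Y. Y \<in> sdp_feasible n K \<Longrightarrow>
      mat_inner (sdp_objective n K A \<theta>) Y \<le> mat_inner (sdp_objective n K A \<theta>) X"
    using sol by (auto simp: sdp_solution_def is_arg_max_linorder)
  have Z: "?Z \<in> sdp_feasible n K" by (rule labeling_mat_feasible[OF z])
  have "expected_score n K \<theta> \<rho> A ?Z \<le> expected_score n K \<theta> \<rho> A X"
    using opt[OF Z] mat_inner_sdp_objective[OF X \<theta>, of A \<rho>] mat_inner_sdp_objective[OF Z \<theta>, of A \<rho>]
    by linarith
  then show ?thesis
    using expected_score_deviation[OF X cut r] expected_score_deviation[OF Z cut r]
    by (simp add: expected_score_labeling_mat[OF z, symmetric])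
qed

section \<open>The randomised estimate\<close>

text \<open>
  Conditionally on the graph, the loss of the randomised estimate is a sum of independent variables, one
  for each pair \<open>i \<le> j\<close>, whose mean is expressed by the expected score of \<open>X\<close>. The summand of a pair
  has size at most \<open>2 \<beta> (P + \<rho>)\<close>, so the second moments add up to at most \<open>16 \<beta>\<^sup>2 n\<^sup>2 \<rho>\<close>. The parameter
  \<open>\<eta>\<close> is chosen so that the scaled summands are at most 1 and their second moments sum to at most \<open>n\<close>.
\<close>

lemma estimate_pmf_concentration:
  fixes P \<theta> X :: "real mat"
  assumes adm: "admissible_model n K c P \<theta>" and n: "n \<ge> 2" and c: "c > 0" and K: "K \<ge> 1"
    and X: "X \<in> sdp_feasible n K" and x: "x \<ge> 0"
  defines "\<rho> \<equiv> mean_density n P"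
  shows "measure_pmf.prob (estimate_pmf n K \<theta> X)
     {Pt. (\<Sum>i<n. \<Sum>j<n. KL (P $$ (i, j)) (Pt $$ (i, j)))
        > (\<Sum>i<n. \<Sum>j<n. entropy_part \<rho> (P $$ (i, j))) - expected_score n K \<theta> \<rho> P X
          + 4 * (ln c + c) * (1 + x) * (real n * sqrt (real n * \<rho>))} \<le> exp (- x)"
proof -
  note A = admissible_modelD[OF adm n, folded \<rho>_def]
  note T = admissible_parameter_bounds[OF adm n c, folded \<rho>_def]
  define V where "V = {..<K} \<times> {..<K}"
  define D where "D = {(i, j). i \<le> j \<and> j < n}"
  define q where "q k = block_pmf K X (fst k) (snd k)" for k
  define \<beta> where "\<beta> = ln c + c"
  define \<eta> where "\<eta> = 1 / (4 * \<beta> * sqrt (real n * \<rho>))"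
  define g where "g k v = (if fst k = snd k then 1 else 2) * score \<theta> \<rho> (P $$ k) v" for k v
  have D: "finite D" unfolding D_def by (rule finite_weak_pairs)
  have Dn: "fst k < n" "snd k < n" if "k \<in> D" for k using that by (auto simp: D_def)
  have PD: "0 \<le> P $$ k" "P $$ k \<le> 1" if "k \<in> D" for k
    using A(6)[of "fst k" "snd k"] Dn[OF that] by auto
  have "(0, 0) \<in> {..<K} \<times> {..<K}" using K by auto
  from T(3)[OF this] have lnc: "0 \<le> ln c" by linarith
  have \<beta>: "\<beta> > 0" using lnc c unfolding \<beta>_def by linarith
  have s1: "sqrt (real n * \<rho>) \<ge> 1" using A(1) by simp
  have \<eta>pos: "\<eta> > 0" using \<beta> s1 A(1) by (simp add: \<eta>_def)
  have pmfq: "pmf (q k) (a, b) = (if a < K \<and> b < K then X $$ (fst k * K + a, snd k * K + b) else 0)" if "k \<in> D" for k a b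
    using pmf_block_pmf[OF X Dn[OF that], of a b] by (simp add: q_def block_def)
  have suppq: "set_pmf (q k) \<subseteq> V" if "k \<in> D" for k
    using pmfq[OF that] by (auto simp: set_pmf_eq V_def split: if_splits)
  have finq: "finite (set_pmf (q k))" if "k \<in> D" for k
    using suppq[OF that] by (rule finite_subset) (simp add: V_def)
  have gbound: "\<bar>g k v\<bar> \<le> 2 * \<beta> * (P $$ k + \<rho>)" if "k \<in> D" "v \<in> V" for k v
  proof -
    have v: "v \<in> {..<K} \<times> {..<K}" using that by (simp add: V_def)
    have "\<bar>score \<theta> \<rho> (P $$ k) v\<bar> \<le> \<bar>P $$ k\<bar> * \<bar>log_odds_ratio \<theta> \<rho> v\<bar> + \<bar>ln (1 - \<theta> $$ v)\<bar>"
      unfolding score_def abs_mult[symmetric] by (rule abs_triangle_ineq)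
    also have "\<dots> \<le> P $$ k * ln c + c * \<rho>"
      using PD[OF that(1)] T[OF v] by (intro add_mono mult_mono) auto
    also have "\<dots> \<le> P $$ k * \<beta> + \<beta> * \<rho>"
      using PD[OF that(1)] A(2) lnc c by (intro add_mono mult_left_mono mult_right_mono) (auto simp: \<beta>_def)
    also have "\<dots> = \<beta> * (P $$ k + \<rho>)" by (simp add: algebra_simps)
    finally have "\<bar>score \<theta> \<rho> (P $$ k) v\<bar> \<le> \<beta> * (P $$ k + \<rho>)" .
    then have "(if fst k = snd k then 1 else 2) * \<bar>score \<theta> \<rho> (P $$ k) v\<bar> \<le> 2 * (\<beta> * (P $$ k + \<rho>))"
      by (intro mult_mono) auto
    then show ?thesis by (simp add: g_def abs_mult mult.assoc split: if_splits)
  qed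
  have mean: "measure_pmf.expectation (q (i, j)) h = (\<Sum>a<K. \<Sum>b<K. h (a, b) * X $$ (i * K + a, j * K + b))"
    if "(i, j) \<in> D" for i j and h :: "nat \<times> nat \<Rightarrow> real"
  proof -
    have "measure_pmf.expectation (q (i, j)) h = (\<Sum>v\<in>V. h v * pmf (q (i, j)) v)"
      using suppq[OF that] by (intro integral_measure_pmf_real) (auto simp: V_def)
    also have "\<dots> = (\<Sum>a<K. \<Sum>b<K. h (a, b) * pmf (q (i, j)) (a, b))"
      unfolding V_def sum.cartesian_product by (intro sum.cong) auto
    also have "\<dots> = (\<Sum>a<K. \<Sum>b<K. h (a, b) * X $$ (i * K + a, j * K + b))"
      by (intro sum.cong refl) (simp add: pmfq[OF that])
    finally show ?thesis .
  qed
  have total_mean: "(\<Sum>k\<in>D. measure_pmf.expectation (q k) (g k)) = expected_score n K \<theta> \<rho> P X"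
  proof -
    let ?e = "\<lambda>i j. \<Sum>a<K. \<Sum>b<K. score \<theta> \<rho> (P $$ (i, j)) (a, b) * X $$ (i * K + a, j * K + b)"
    have swap: "?e j i = ?e i j" if "i < n" "j < n" for i j
    proof -
      have "?e j i = (\<Sum>a<K. \<Sum>b<K. score \<theta> \<rho> (P $$ (i, j)) (b, a) * X $$ (i * K + b, j * K + a))"
        using that A(5)[of i j] A(8) sdp_feasibleD(2)[OF X] block_index_less
        by (intro sum.cong refl) (simp add: score_def log_odds_ratio_def)
      also have "\<dots> = ?e i j" by (rule sum.swap)
      finally show ?thesis .
    qed
    have "expected_score n K \<theta> \<rho> P X = (\<Sum>(i, j)\<in>D. if i = j then ?e i i else ?e i j + ?e j i)"
      unfolding expected_score_def D_def by (rule sum_square_eq_weak_pairs)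
    also have "\<dots> = (\<Sum>k\<in>D. measure_pmf.expectation (q k) (g k))"
    proof (intro sum.cong refl, clarify)
      fix i j assume ij: "(i, j) \<in> D"
      then have "?e j i = ?e i j" by (intro swap) (auto simp: D_def)
      then show "(if i = j then ?e i i else ?e i j + ?e j i) = measure_pmf.expectation (q (i, j)) (g (i, j))"
        unfolding mean[OF ij] g_def by (simp add: sum_distrib_left mult.assoc)
    qed
    finally show ?thesis by simp
  qed
  have KLsum: "(\<Sum>i<n. \<Sum>j<n. KL (P $$ (i, j)) (\<theta> $$ s (min i j, max i j)))
      = (\<Sum>i<n. \<Sum>j<n. entropy_part \<rho> (P $$ (i, j))) - (\<Sum>k\<in>D. g k (s k))"
    if s: "\<And>k. k \<in> D \<Longrightarrow> s k \<in> V" for s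
  proof -
    have "(\<Sum>i<n. \<Sum>j<n. KL (P $$ (i, j)) (\<theta> $$ s (min i j, max i j)))
        = (\<Sum>i<n. \<Sum>j<n. entropy_part \<rho> (P $$ (i, j)) - score \<theta> \<rho> (P $$ (i, j)) (s (min i j, max i j)))"
    proof (intro sum.cong refl KL_eq_entropy_part_minus_score)
      fix i j assume "i \<in> {..<n}" "j \<in> {..<n}"
      then have "s (min i j, max i j) \<in> V" by (intro s) (auto simp: D_def)
      then show "0 < \<theta> $$ s (min i j, max i j)" "\<theta> $$ s (min i j, max i j) < 1"
        using T(1,2) by (auto simp: V_def)
    qed (use A(6) in auto)
    also have "\<dots> = (\<Sum>i<n. \<Sum>j<n. entropy_part \<rho> (P $$ (i, j)))
        - (\<Sum>i<n. \<Sum>j<n. score \<theta> \<rho> (P $$ (i, j)) (s (min i j, max i j)))"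
      by (simp add: sum_subtractf)
    also have "(\<Sum>i<n. \<Sum>j<n. score \<theta> \<rho> (P $$ (i, j)) (s (min i j, max i j))) = (\<Sum>k\<in>D. g k (s k))"
      unfolding sum_square_eq_weak_pairs D_def[symmetric]
      by (intro sum.cong refl) (use A(5) in \<open>auto simp: g_def D_def min_def max_def\<close>)
    finally show ?thesis .
  qed
  have small: "\<bar>- \<eta> * g k v\<bar> \<le> 1" if "k \<in> D" "v \<in> set_pmf (q k)" for k v
  proof -
    have "\<bar>g k v\<bar> \<le> 2 * \<beta> * (P $$ k + \<rho>)" using gbound that suppq by blast
    also have "\<dots> \<le> 2 * \<beta> * (1 + 1)" using PD[OF that(1)] A(3) \<beta> by (intro mult_left_mono add_mono) auto
    also have "\<dots> \<le> 4 * \<beta> * sqrt (real n * \<rho>)" using s1 \<beta> by simp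
    finally show ?thesis using \<beta> s1 by (simp add: \<eta>_def abs_mult field_simps)
  qed
  have second: "(\<Sum>k\<in>D. measure_pmf.expectation (q k) (\<lambda>v. (- \<eta> * g k v)^2)) \<le> real n"
  proof -
    have "measure_pmf.expectation (q k) (\<lambda>v. (- \<eta> * g k v)^2) \<le> 8 * \<beta>^2 * \<eta>^2 * (P $$ k + \<rho>)" if k: "k \<in> D" for k
    proof -
      have "(- \<eta> * g k v)^2 \<le> 8 * \<beta>^2 * \<eta>^2 * (P $$ k + \<rho>)" if "v \<in> set_pmf (q k)" for v
      proof -
        have "(g k v)^2 \<le> (2 * \<beta> * (P $$ k + \<rho>))^2"
          using gbound[OF k] suppq[OF k] that by (intro abs_le_square_iff[THEN iffD1]) fastforce
        also have "\<dots> = 4 * \<beta>^2 * ((P $$ k + \<rho>) * (P $$ k + \<rho>))" by (simp add: power2_eq_square)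
        also have "\<dots> \<le> 4 * \<beta>^2 * (2 * (P $$ k + \<rho>))"
          using PD[OF k] A(2,3) by (intro mult_left_mono mult_right_mono) auto
        finally have "\<eta>^2 * (g k v)^2 \<le> \<eta>^2 * (4 * \<beta>^2 * (2 * (P $$ k + \<rho>)))"
          by (intro mult_left_mono) auto
        then show ?thesis by (simp add: power_mult_distrib algebra_simps)
      qed
      then have "measure_pmf.expectation (q k) (\<lambda>v. (- \<eta> * g k v)^2)
          \<le> measure_pmf.expectation (q k) (\<lambda>v. 8 * \<beta>^2 * \<eta>^2 * (P $$ k + \<rho>))"
        by (intro integral_mono_AE integrable_measure_pmf_finite finq k) (auto simp: AE_measure_pmf_iff)
      then show ?thesis by simp
    qed
    then have "(\<Sum>k\<in>D. measure_pmf.expectation (q k) (\<lambda>v. (- \<eta> * g k v)^2))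
        \<le> (\<Sum>k\<in>D. 8 * \<beta>^2 * \<eta>^2 * (P $$ k + \<rho>))" by (intro sum_mono)
    also have "\<dots> = 8 * \<beta>^2 * \<eta>^2 * (\<Sum>k\<in>D. P $$ k + \<rho>)" by (simp add: sum_distrib_left)
    also have "(\<Sum>k\<in>D. P $$ k + \<rho>) \<le> (\<Sum>k\<in>{..<n} \<times> {..<n}. P $$ k + \<rho>)"
      using A(2,6) by (intro sum_mono2) (auto simp: D_def intro!: add_nonneg_nonneg)
    also have "\<dots> = (\<Sum>i<n. \<Sum>j<n. P $$ (i, j)) + real n ^ 2 * \<rho>"
      by (simp add: sum.distrib sum.cartesian_product power2_eq_square)
    also have "\<dots> \<le> 2 * (real n ^ 2 * \<rho>)" using A(4) by linarith
    finally have "(\<Sum>k\<in>D. measure_pmf.expectation (q k) (\<lambda>v. (- \<eta> * g k v)^2))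
        \<le> 8 * \<beta>^2 * \<eta>^2 * (2 * (real n ^ 2 * \<rho>))"
      by (simp add: mult_left_mono)
    also have "\<dots> = real n"
      using \<beta> A(1,2) n by (simp add: \<eta>_def power_divide power_mult_distrib field_simps power2_eq_square)
    finally show ?thesis .
  qed
  let ?t = "4 * \<beta> * (1 + x) * (real n * sqrt (real n * \<rho>))"
  let ?Q = "Pi_pmf D (0, 0) q"
  have Q: "estimate_pmf n K \<theta> X = map_pmf (\<lambda>s. Matrix.mat n n (\<lambda>(i, j). \<theta> $$ s (min i j, max i j))) ?Q"
    unfolding estimate_pmf_def D_def[symmetric]
    by (intro arg_cong2[where f = map_pmf] Pi_pmf_cong refl) (auto simp: q_def)
  have "measure_pmf.prob (estimate_pmf n K \<theta> X)
     {Pt. (\<Sum>i<n. \<Sum>j<n. KL (P $$ (i, j)) (Pt $$ (i, j)))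
        > (\<Sum>i<n. \<Sum>j<n. entropy_part \<rho> (P $$ (i, j))) - expected_score n K \<theta> \<rho> P X + ?t}
    = measure_pmf.prob ?Q
     {s. (\<Sum>i<n. \<Sum>j<n. KL (P $$ (i, j)) (\<theta> $$ s (min i j, max i j)))
        > (\<Sum>i<n. \<Sum>j<n. entropy_part \<rho> (P $$ (i, j))) - expected_score n K \<theta> \<rho> P X + ?t}"
    unfolding Q by (simp add: vimage_def)
  also have "\<dots> \<le> measure_pmf.prob ?Q {s. real n * (1 + x) \<le> (\<Sum>k\<in>D. - \<eta> * g k (s k) - measure_pmf.expectation (q k) (\<lambda>v. - \<eta> * g k v))}"
  proof (intro measure_pmf.finite_measure_mono_AE, simp_all only: AE_measure_pmf_iff, intro ballI impI, goal_cases)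
    case (1 s)
    have s: "s k \<in> V" if "k \<in> D" for k
      using 1(1) suppq[OF that] that by (cases k) (auto simp: set_Pi_pmf[OF D] PiE_dflt_def)
    have "?t < expected_score n K \<theta> \<rho> P X - (\<Sum>k\<in>D. g k (s k))"
      using 1(2) KLsum[of s, OF s] by simp
    then have "\<eta> * ?t \<le> \<eta> * (expected_score n K \<theta> \<rho> P X - (\<Sum>k\<in>D. g k (s k)))"
      using \<eta>pos by (intro mult_left_mono) auto
    also have "\<dots> = (\<Sum>k\<in>D. - \<eta> * g k (s k) - measure_pmf.expectation (q k) (\<lambda>v. - \<eta> * g k v))"
      by (simp add: total_mean[symmetric] sum_subtractf sum_negf sum_distrib_left right_diff_distrib)
    also have "\<eta> * ?t = real n * (1 + x)"
      using \<beta> A(1,2) s1 by (simp add: \<eta>_def)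
    finally show ?case by simp
  qed auto
  also have "\<dots> \<le> exp ((\<Sum>k\<in>D. measure_pmf.expectation (q k) (\<lambda>v. (- \<eta> * g k v)^2)) - real n * (1 + x))"
    by (rule Pi_pmf_sum_tail) (use D finq small in auto)
  also have "\<dots> \<le> exp (real n - real n * (1 + x))" using second by simp
  also have "\<dots> \<le> exp (- x)"
    using n x mult_right_mono[of 1 "real n" x] by (simp add: algebra_simps)
  finally show ?thesis by (simp add: \<beta>_def)
qed

text \<open>
  One factor \<open>exp (- x)\<close> pays for graphs whose noise has a large cut norm, the other for the random draw
  of classes.
\<close>

lemma oracle_inequality:
  fixes P \<theta> :: "real mat"
  assumes adm: "admissible_model n K c P \<theta>" and n: "n \<ge> 2" and c: "c > 0" and K: "K \<ge> 1" and x: "x \<ge> 0"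
    and sol: "\<And>A. A \<in> set_pmf (graph_pmf n P) \<Longrightarrow> sdp_solution n K A \<theta> (Xhat A)"
    and M: "M = 196 * real K ^ 2 * ln c * (5 + 2 * x) + 4 * (ln c + c) * (1 + x)"
  defines "\<rho> \<equiv> mean_density n P"
  shows "measure_pmf.prob (randomized_estimate_pmf n K P \<theta> Xhat)
     {Pt. (1 / ((real n)^2 * \<rho>)) * (\<Sum>i<n. \<Sum>j<n. KL (P $$ (i, j)) (Pt $$ (i, j)))
        > (1 / ((real n)^2 * \<rho>)) *
            (MIN z \<in> {..<n} \<rightarrow>\<^sub>E {..<K}. \<Sum>i<n. \<Sum>j<n. KL (P $$ (i, j)) (\<theta> $$ (z i, z j)))
          + M * (1 / sqrt (real n * \<rho>))} \<le> 2 * exp (- x)" (is "measure_pmf.prob _ ?E \<le> _")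
proof -
  note A = admissible_modelD[OF adm n, folded \<rho>_def]
  note T = admissible_parameter_bounds[OF adm n c, folded \<rho>_def]
  define s where "s = real n * sqrt (real n * \<rho>)"
  define L where "L z = (\<Sum>i<n. \<Sum>j<n. KL (P $$ (i, j)) (\<theta> $$ (z i, z j)))" for z
  define base where "base = (\<Sum>i<n. \<Sum>j<n. entropy_part \<rho> (P $$ (i, j)))"
  define bad where "bad = {A. \<not> cut_bound n (\<lambda>i j. P $$ (i, j) - A $$ (i, j)) ((5 + 2 * x) * real n * sqrt (real n * \<rho>))}"
  have "finite ({..<n} \<rightarrow>\<^sub>E {..<K})" by (intro finite_PiE) auto
  moreover have "{..<n} \<rightarrow>\<^sub>E {..<K} \<noteq> {}" using K by (auto simp: PiE_eq_empty_iff lessThan_empty_iff)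
  ultimately have "Min (L ` ({..<n} \<rightarrow>\<^sub>E {..<K})) \<in> L ` ({..<n} \<rightarrow>\<^sub>E {..<K})" by (intro Min_in) auto
  then obtain z where z: "z \<in> {..<n} \<rightarrow>\<^sub>E {..<K}" and Lz: "Min (L ` ({..<n} \<rightarrow>\<^sub>E {..<K})) = L z" by auto
  have zK: "z \<in> {..<n} \<rightarrow> {..<K}" using z by auto
  have Lz_eq: "L z = base - (\<Sum>i<n. \<Sum>j<n. score \<theta> \<rho> (P $$ (i, j)) (z i, z j))"
    unfolding L_def base_def sum_subtractf[symmetric]
    by (intro sum.cong refl KL_eq_entropy_part_minus_score) (use A(6) T(1,2) zK in \<open>auto simp: Pi_iff\<close>)
  \<comment> \<open>Multiplication by \<open>n\<^sup>2 \<rho>\<close> turns the rate \<open>1 / sqrt (n \<rho>)\<close> into \<open>s\<close>.\<close>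
  have scale: "(y > L z + M * s) = ((1 / ((real n)^2 * \<rho>)) * y > (1 / ((real n)^2 * \<rho>)) * L z + M * (1 / sqrt (real n * \<rho>)))" for y
  proof -
    have w: "(real n)^2 * \<rho> > 0" using A(2) n by simp
    have "1 / sqrt (real n * \<rho>) = (1 / ((real n)^2 * \<rho>)) * s"
    proof -
      have "(real n)^2 * \<rho> = real n * (sqrt (real n * \<rho>) * sqrt (real n * \<rho>))"
        using A(1) by (simp add: power2_eq_square)
      then show ?thesis using n A(1,2) unfolding s_def by (simp only:) (simp add: field_simps)
    qed
    then have "(1 / ((real n)^2 * \<rho>)) * L z + M * (1 / sqrt (real n * \<rho>)) = (1 / ((real n)^2 * \<rho>)) * (L z + M * s)"
      by (simp only:) (simp add: add_divide_distrib)
    then show ?thesis using w by (simp only: mult_less_cancel_left_pos zero_less_divide_1_iff)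
  qed
  have "measure_pmf.prob (estimate_pmf n K \<theta> (Xhat B)) ?E \<le> exp (- x)"
    if B: "B \<in> set_pmf (graph_pmf n P)" and good: "B \<notin> bad" for B
  proof -
    have opt: "sdp_solution n K B \<theta> (Xhat B)" by (rule sol[OF B])
    then have X: "Xhat B \<in> sdp_feasible n K" by (simp add: sdp_solution_def is_arg_max_def)
    have "(\<Sum>i<n. \<Sum>j<n. score \<theta> \<rho> (P $$ (i, j)) (z i, z j)) \<le> expected_score n K \<theta> \<rho> P (Xhat B)
        + 196 * real K ^ 2 * ln c * ((5 + 2 * x) * real n * sqrt (real n * \<rho>))"
      by (rule sdp_solution_near_optimal[OF opt _ _ _ zK]) (use good T in \<open>auto simp: bad_def\<close>)
    then have "base - expected_score n K \<theta> \<rho> P (Xhat B) + 4 * (ln c + c) * (1 + x) * s \<le> L z + M * s"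
      by (simp add: Lz_eq M s_def algebra_simps)
    then have "?E \<subseteq> {Pt. (\<Sum>i<n. \<Sum>j<n. KL (P $$ (i, j)) (Pt $$ (i, j)))
        > base - expected_score n K \<theta> \<rho> P (Xhat B) + 4 * (ln c + c) * (1 + x) * s}"
      unfolding L_def[symmetric] Lz scale[symmetric] by auto
    then have "measure_pmf.prob (estimate_pmf n K \<theta> (Xhat B)) ?E \<le> measure_pmf.prob (estimate_pmf n K \<theta> (Xhat B))
        {Pt. (\<Sum>i<n. \<Sum>j<n. KL (P $$ (i, j)) (Pt $$ (i, j)))
        > base - expected_score n K \<theta> \<rho> P (Xhat B) + 4 * (ln c + c) * (1 + x) * s}"
      by (intro measure_pmf.finite_measure_mono) auto
    also have "\<dots> \<le> exp (- x)"
      using estimate_pmf_concentration[OF adm n c K X x] by (simp add: base_def s_def \<rho>_def)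
    finally show ?thesis .
  qed
  then have "measure_pmf.prob (randomized_estimate_pmf n K P \<theta> Xhat) ?E \<le> measure_pmf.prob (graph_pmf n P) bad + exp (- x)"
    unfolding randomized_estimate_pmf_def by (intro prob_bind_pmf_le) auto
  also have "measure_pmf.prob (graph_pmf n P) bad \<le> exp (- x)"
    unfolding bad_def using A n x by (intro cut_bound_random_graph) auto
  finally show ?thesis by simp
qed

theorem theorem1:
  fixes K :: nat and c :: real
  assumes "K \<ge> 1" and "c > 0"
  shows "\<forall>\<epsilon>>0. \<exists>M::real.
    \<forall>(P :: nat \<Rightarrow> real mat) (\<theta> :: nat \<Rightarrow> real mat) (Xhat :: nat \<Rightarrow> real mat \<Rightarrow> real mat).
      (\<forall>n\<ge>2. admissible_model n K c (P n) (\<theta> n) \<and>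
         (\<forall>A \<in> set_pmf (graph_pmf n (P n)). sdp_solution n K A (\<theta> n) (Xhat n A))) \<longrightarrow>
      (\<forall>n\<ge>2. let \<rho> = mean_density n (P n) in
         measure_pmf.prob (randomized_estimate_pmf n K (P n) (\<theta> n) (Xhat n))
           {Pt. (1 / ((real n)^2 * \<rho>)) * (\<Sum>i<n. \<Sum>j<n. KL (P n $$ (i, j)) (Pt $$ (i, j)))
              > (1 / ((real n)^2 * \<rho>)) *
                  (MIN z \<in> {..<n} \<rightarrow>\<^sub>E {..<K}.
                     \<Sum>i<n. \<Sum>j<n. KL (P n $$ (i, j)) (\<theta> n $$ (z i, z j)))
                + M * (1 / sqrt (real n * \<rho>))} \<le> \<epsilon>)"
proof (intro allI impI)
  fix \<epsilon> :: real assume \<epsilon>: "\<epsilon> > 0"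
  \<comment> \<open>Solves \<open>2 * exp (- x) \<le> \<epsilon>\<close> within the range \<open>x \<ge> 0\<close> of the oracle inequality.\<close>
  define x where "x = max 0 (ln (2 / \<epsilon>))"
  define M where "M = 196 * real K ^ 2 * ln c * (5 + 2 * x) + 4 * (ln c + c) * (1 + x)"
  have "2 / \<epsilon> = exp (ln (2 / \<epsilon>))" using \<epsilon> by simp
  also have "\<dots> \<le> exp x" by (simp add: x_def)
  finally have "2 * exp (- x) \<le> \<epsilon>" using \<epsilon> by (simp add: exp_minus field_simps)
  then show "\<exists>M::real. \<forall>P \<theta> Xhat.
      (\<forall>n\<ge>2. admissible_model n K c (P n) (\<theta> n) \<and>
         (\<forall>A \<in> set_pmf (graph_pmf n (P n)). sdp_solution n K A (\<theta> n) (Xhat n A))) \<longrightarrow>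
      (\<forall>n\<ge>2. let \<rho> = mean_density n (P n) in
         measure_pmf.prob (randomized_estimate_pmf n K (P n) (\<theta> n) (Xhat n))
           {Pt. (1 / ((real n)^2 * \<rho>)) * (\<Sum>i<n. \<Sum>j<n. KL (P n $$ (i, j)) (Pt $$ (i, j)))
              > (1 / ((real n)^2 * \<rho>)) *
                  (MIN z \<in> {..<n} \<rightarrow>\<^sub>E {..<K}.
                     \<Sum>i<n. \<Sum>j<n. KL (P n $$ (i, j)) (\<theta> n $$ (z i, z j)))
                + M * (1 / sqrt (real n * \<rho>))} \<le> \<epsilon>)"
    unfolding Let_def
    using assms by (intro exI[of _ M] allI impI order_trans[OF oracle_inequality[OF _ _ _ _ _ _ M_def]])
      (auto simp: x_def)
qed

end
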